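(* Let $k\ge 2$, $\alpha\in(0,1]$, and privacy parameters $\varepsilon_1,\varepsilon_2>0$ with $\varepsilon_2\le\varepsilon_1$. There exists an algorithm for closeness testing between two unknown distributions $\mathbf p,\mathbf q$ over $[k]$ with distance parameter $\alpha$ which guarantees $\varepsilon_1$-differential privacy to the $n_1$ users holding samples from $\mathbf p$ and $\varepsilon_2$-differential privacy to the $n_2$ users holding samples from $\mathbf q$, with $$n_1=O\!\left(\max\!\left(\frac{k^{1/2}}{\alpha^2},\frac{k^{1/2}}{\varepsilon_1^{1/2}\alpha},\frac{k^{2/3}}{\alpha^{4/3}},\frac{k^{1/3}}{\varepsilon_1^{2/3}\alpha^{4/3}},\frac{1}{\varepsilon_1\alpha}\right)\right)$$ and $n_2=O\!\left(\frac{\varepsilon_1}{\varepsilon_2}n_1\right)$.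
   Context: Closeness testing: given $\alpha\in(0,1]$, a dataset of $n_1$ independent samples from an unknown distribution $\mathbf p$ over $[k]$ and a dataset of $n_2$ independent samples from an unknown distribution $\mathbf q$ over $[k]$, output accept with probability at least $2/3$ if $\mathbf p=\mathbf q$, and reject with probability at least $2/3$ if $d_{TV}(\mathbf p,\mathbf q)=\frac12\|\mathbf p-\mathbf q\|_1>\alpha$. Heterogeneous central differential privacy: the (randomized) algorithm $\mathcal A$ takes both datasets as input; it guarantees $\varepsilon_1$-differential privacy to the first group if for every fixed second dataset, every pair of first datasets differing in one entry, and every set $S$ of outputs, $\Pr[\mathcal A(\cdot)\in S]\le e^{\varepsilon_1}\Pr[\mathcal A(\cdot')\in S]$; and $\varepsilon_2$-differential privacy to the second group analogously with the roles of the datasets swapped. *)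

theory Defs
  imports "HOL-Probability.Probability"
begin

datatype verdict = Accept | Reject

definition datasets :: "nat \<Rightarrow> nat \<Rightarrow> nat list set" where
  "datasets k n = {xs. length xs = n \<and> set xs \<subseteq> {1..k}}"

definition differ_in_one_entry :: "'a list \<Rightarrow> 'a list \<Rightarrow> bool" where
  "differ_in_one_entry xs ys \<longleftrightarrow>
     length xs = length ys \<and> card {i. i < length xs \<and> xs ! i \<noteq> ys ! i} = 1"

definition differentially_private ::
    "real \<Rightarrow> 'a list set \<Rightarrow> ('a list \<Rightarrow> 'b pmf) \<Rightarrow> bool" where
  "differentially_private \<epsilon> D M \<longleftrightarrow>
     (\<forall>xs\<in>D. \<forall>xs'\<in>D. differ_in_one_entry xs xs' \<longrightarrow>
        (\<forall>S. measure_pmf.prob (M xs) S \<le> exp \<epsilon> * measure_pmf.prob (M xs') S))"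

text \<open>A distribution over \<open>[k]\<close> is a \<open>nat pmf\<close> whose support lies in \<open>{1..k}\<close>; the sum below
  is the full \<open>\<ell>\<^sub>1\<close> distance only for such distributions.\<close>

definition dist_TV :: "nat \<Rightarrow> nat pmf \<Rightarrow> nat pmf \<Rightarrow> real" where
  "dist_TV k p q = (1 / 2) * (\<Sum>i\<in>{1..k}. \<bar>pmf p i - pmf q i\<bar>)"

text \<open>A randomized algorithm, for fixed sample sizes, maps the two datasets to a distribution over
  verdicts. Running it on independent samples averages over the samples and over its own coins.\<close>

definition run_on_samples ::
    "nat \<Rightarrow> nat \<Rightarrow> ('a list \<Rightarrow> 'a list \<Rightarrow> 'b pmf) \<Rightarrow> 'a pmf \<Rightarrow> 'a pmf \<Rightarrow> 'b pmf" where
  "run_on_samples n1 n2 A p q =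
     bind_pmf (replicate_pmf n1 p) (\<lambda>xs. bind_pmf (replicate_pmf n2 q) (\<lambda>ys. A xs ys))"

definition closeness_tester ::
    "nat \<Rightarrow> real \<Rightarrow> nat \<Rightarrow> nat \<Rightarrow> (nat list \<Rightarrow> nat list \<Rightarrow> verdict pmf) \<Rightarrow> bool" where
  "closeness_tester k \<alpha> n1 n2 A \<longleftrightarrow>
     (\<forall>p q. set_pmf p \<subseteq> {1..k} \<longrightarrow> set_pmf q \<subseteq> {1..k} \<longrightarrow>
        (p = q \<longrightarrow> measure_pmf.prob (run_on_samples n1 n2 A p q) {Accept} \<ge> 2 / 3) \<and>
        (dist_TV k p q > \<alpha> \<longrightarrow> measure_pmf.prob (run_on_samples n1 n2 A p q) {Reject} \<ge> 2 / 3))"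

definition private_to_first ::
    "nat \<Rightarrow> real \<Rightarrow> nat \<Rightarrow> nat \<Rightarrow> (nat list \<Rightarrow> nat list \<Rightarrow> 'b pmf) \<Rightarrow> bool" where
  "private_to_first k \<epsilon> n1 n2 A \<longleftrightarrow>
     (\<forall>ys\<in>datasets k n2. differentially_private \<epsilon> (datasets k n1) (\<lambda>xs. A xs ys))"

definition private_to_second ::
    "nat \<Rightarrow> real \<Rightarrow> nat \<Rightarrow> nat \<Rightarrow> (nat list \<Rightarrow> nat list \<Rightarrow> 'b pmf) \<Rightarrow> bool" where
  "private_to_second k \<epsilon> n1 n2 A \<longleftrightarrow>
     (\<forall>xs\<in>datasets k n1. differentially_private \<epsilon> (datasets k n2) (\<lambda>ys. A xs ys))"

end

theory Submission
  imports Defs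
begin

text \<open>
  Take \<open>n\<^sub>1 = 2 m\<close> and \<open>n\<^sub>2 = 2 r m\<close> with \<open>r = \<lceil>\<epsilon>\<^sub>1 / \<epsilon>\<^sub>2\<rceil>\<close>. Each half of the first sample is one block
  of length \<open>m\<close>, each half of the second consists of \<open>r\<close> such blocks. Averaging over the blocks the
  indicator that symbol \<open>i\<close> occurs at most \<open>t\<close> times gives an unbiased estimate of the distribution
  function \<open>F\<^sub>i(t)\<close> of Bin(\<open>m\<close>, \<open>p\<^sub>i\<close>), respectively \<open>G\<^sub>i(t)\<close> of Bin(\<open>m\<close>, \<open>q\<^sub>i\<close>). The products of the
  differences of these estimates over the two halves sum up to a statistic \<open>Z\<close> with mean
  \<open>\<Sum>\<^sub>i \<Sum>\<^sub>t (F\<^sub>i(t) - G\<^sub>i(t))\<^sup>2\<close>, which vanishes for \<open>p = q\<close>. Changing one entry of the first sample moves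
  \<open>Z\<close> by at most 2, one entry of the second by at most \<open>2 / r\<close>; hence the variance is \<open>O(m)\<close> by
  Efron-Stein, and rejecting with probability logistic(\<open>\<epsilon>\<^sub>1 (Z - \<tau>) / 2\<close>) is private with parameters
  \<open>\<epsilon>\<^sub>1\<close> and \<open>\<epsilon>\<^sub>1 / r \<le> \<epsilon>\<^sub>2\<close>. Since \<open>\<Sum>\<^sub>t (F\<^sub>i(t) - G\<^sub>i(t)) = m (q\<^sub>i - p\<^sub>i)\<close> is concentrated on a window of length
  \<open>O(m \<bar>p\<^sub>i - q\<^sub>i\<bar> + \<surd>(m (p\<^sub>i + q\<^sub>i)) + 1)\<close>, two applications of Cauchy-Schwarz bound the mean of \<open>Z\<close>
  from below by a multiple of \<open>(m \<alpha>)\<^sup>2 / (m \<alpha> + \<surd>(m k) + k)\<close>. The five terms of the sample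
  complexity are what makes this exceed both the noise level \<open>1 / \<epsilon>\<^sub>1\<close> and the standard deviation
  \<open>\<surd>m\<close>.
\<close>

section \<open>Distance of binomial distribution functions\<close>

text \<open>The expectation of \<open>f\<close> at a sum of independent Bernoulli variables with the given parameters.\<close>

primrec poisson_binomial :: "real list \<Rightarrow> (nat \<Rightarrow> real) \<Rightarrow> real" where
  "poisson_binomial [] f = f 0"
| "poisson_binomial (p # ps) f =
     (1 - p) * poisson_binomial ps f + p * poisson_binomial ps (\<lambda>c. f (Suc c))"

section \<open>Calculus of Poisson-binomial expectations\<close>

lemma poisson_binomial_add:
  "poisson_binomial ps (\<lambda>c. f c + g c) = poisson_binomial ps f + poisson_binomial ps g"
  by (induction ps arbitrary: f g) (simp_all add: algebra_simps)

lemma poisson_binomial_cmult: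
  "poisson_binomial ps (\<lambda>c. a * f c) = a * poisson_binomial ps f"
  by (induction ps arbitrary: f) (simp_all add: algebra_simps)

lemma poisson_binomial_const: "poisson_binomial ps (\<lambda>c. a) = a"
  by (induction ps) (simp_all add: algebra_simps)

lemma poisson_binomial_diff:
  "poisson_binomial ps (\<lambda>c. f c - g c) = poisson_binomial ps f - poisson_binomial ps g"
  using poisson_binomial_add[of ps f "\<lambda>c. (-1) * g c"] poisson_binomial_cmult[of ps "-1" g]
  by simp

lemma poisson_binomial_sum:
  "finite T \<Longrightarrow>
    poisson_binomial ps (\<lambda>c. \<Sum>t\<in>T. f t c) = (\<Sum>t\<in>T. poisson_binomial ps (f t))"
  by (induction T rule: finite_induct)
     (simp_all add: poisson_binomial_const poisson_binomial_add)

lemma poisson_binomial_mono: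
  assumes "set ps \<subseteq> {0..1}" "\<And>c. c \<le> length ps \<Longrightarrow> f c \<le> g c"
  shows "poisson_binomial ps f \<le> poisson_binomial ps g"
  using assms
proof (induction ps arbitrary: f g)
  case (Cons p ps)
  have "poisson_binomial ps f \<le> poisson_binomial ps g"
    using Cons.prems by (intro Cons.IH) auto
  moreover have "poisson_binomial ps (\<lambda>c. f (Suc c)) \<le> poisson_binomial ps (\<lambda>c. g (Suc c))"
    using Cons.prems by (intro Cons.IH) auto
  ultimately show ?case
    using Cons.prems(1) by (auto intro!: add_mono mult_left_mono)
qed simp

lemma poisson_binomial_cong:
  assumes "\<And>c. c \<le> length ps \<Longrightarrow> f c = g c"
  shows "poisson_binomial ps f = poisson_binomial ps g"
  using assms
proof (induction ps arbitrary: f g)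
  case (Cons p ps)
  have "poisson_binomial ps f = poisson_binomial ps g"
    using Cons.prems by (intro Cons.IH) auto
  moreover have "poisson_binomial ps (\<lambda>c. f (Suc c)) = poisson_binomial ps (\<lambda>c. g (Suc c))"
    using Cons.prems by (intro Cons.IH) auto
  ultimately show ?case by simp
qed simp

text \<open>Bias-variance decomposition. The centre \<open>a\<close> is arbitrary, so that a success
  in the induction step is absorbed by passing to \<open>a - 1\<close>.\<close>

lemma poisson_binomial_square:
  "poisson_binomial ps (\<lambda>c. (real c - a)\<^sup>2) =
     (sum_list ps - a)\<^sup>2 + (\<Sum>p\<leftarrow>ps. p * (1 - p))"
proof (induction ps arbitrary: a)
  case (Cons p ps)
  have "(\<lambda>c. (real (Suc c) - a)\<^sup>2) = (\<lambda>c. (real c - (a - 1))\<^sup>2)"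
    by (auto simp: algebra_simps)
  hence "poisson_binomial (p # ps) (\<lambda>c. (real c - a)\<^sup>2) =
     (1 - p) * ((sum_list ps - a)\<^sup>2 + (\<Sum>p\<leftarrow>ps. p * (1 - p))) +
      p * ((sum_list ps - (a - 1))\<^sup>2 + (\<Sum>p\<leftarrow>ps. p * (1 - p)))"
    using Cons.IH by simp
  thus ?case by (simp add: algebra_simps power2_eq_square)
qed simp

text \<open>The indicator dominates \<open>1 - ((c - a) / w)\<^sup>2\<close>, and the variance is at
  most the mean. The centre \<open>a\<close> is free, so that one window can serve many parameter
  lists.\<close>

lemma poisson_binomial_chebyshev:
  assumes "set ps \<subseteq> {0..1}" "w > 0"
  shows "poisson_binomial ps (\<lambda>c. of_bool (\<bar>real c - a\<bar> \<le> w)) \<ge>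
           1 - ((sum_list ps - a)\<^sup>2 + sum_list ps) / w\<^sup>2"
proof -
  have "(\<Sum>p\<leftarrow>ps. p * (1 - p)) \<le> sum_list (map (\<lambda>p. p) ps)"
    using assms(1) by (intro sum_list_mono) (auto simp: algebra_simps)
  hence "1 - ((sum_list ps - a)\<^sup>2 + sum_list ps) / w\<^sup>2 \<le>
         1 - (1 / w\<^sup>2) * ((sum_list ps - a)\<^sup>2 + (\<Sum>p\<leftarrow>ps. p * (1 - p)))"
    using assms(2) by (simp add: divide_right_mono)
  also have "\<dots> = poisson_binomial ps (\<lambda>c. 1 - (1 / w\<^sup>2) * (real c - a)\<^sup>2)"
    by (simp only: poisson_binomial_diff poisson_binomial_cmult poisson_binomial_const
        poisson_binomial_square)
  also have "\<dots> \<le> poisson_binomial ps (\<lambda>c. of_bool (\<bar>real c - a\<bar> \<le> w))"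
  proof (rule poisson_binomial_mono[OF assms(1)])
    fix c
    show "1 - (1 / w\<^sup>2) * (real c - a)\<^sup>2 \<le> of_bool (\<bar>real c - a\<bar> \<le> w)"
    proof (cases "\<bar>real c - a\<bar> \<le> w")
      case False
      hence "w\<^sup>2 \<le> \<bar>real c - a\<bar>\<^sup>2" using assms(2) by (intro power_mono) auto
      thus ?thesis using False assms(2) by (simp add: field_simps)
    qed simp
  qed
  finally show ?thesis .
qed

lemma poisson_binomial_insert:
  "poisson_binomial (us @ x # vs) f =
     (1 - x) * poisson_binomial (us @ vs) f + x * poisson_binomial (us @ vs) (\<lambda>c. f (Suc c))"
proof (induction us arbitrary: f)
  case (Cons u us)
  show ?case
    unfolding append_Cons poisson_binomial.simps Cons.IH by (simp add: algebra_simps)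
qed (simp add: algebra_simps)

text \<open>Lindeberg exchange: the parameters are changed from \<open>p\<close> to \<open>q\<close> one at a time.\<close>

lemma poisson_binomial_exchange:
  "poisson_binomial (replicate m q) f - poisson_binomial (replicate m p) f =
     (q - p) * (\<Sum>j<m. poisson_binomial (replicate j q @ replicate (m - 1 - j) p)
       (\<lambda>c. f (Suc c) - f c))"
proof -
  define h where "h j = poisson_binomial (replicate j q @ replicate (m - j) p) f" for j
  have "h (Suc j) - h j = (q - p) *
      poisson_binomial (replicate j q @ replicate (m - 1 - j) p) (\<lambda>c. f (Suc c) - f c)"
    if "j < m" for j
  proof -
    have 1: "replicate (Suc j) q @ replicate (m - Suc j) p =
        replicate j q @ q # replicate (m - 1 - j) p"
      by (simp add: replicate_app_Cons_same)
    have "m - j = Suc (m - 1 - j)" using that by simp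
    hence 2: "replicate j q @ replicate (m - j) p = replicate j q @ p # replicate (m - 1 - j) p"
      by simp
    show ?thesis
      unfolding h_def 1 2 poisson_binomial_insert poisson_binomial_diff by (simp add: algebra_simps)
  qed
  hence "(\<Sum>j<m. h (Suc j) - h j) = (q - p) * (\<Sum>j<m. poisson_binomial
      (replicate j q @ replicate (m - 1 - j) p) (\<lambda>c. f (Suc c) - f c))"
    by (simp add: sum_distrib_left)
  moreover have "(\<Sum>j<m. h (Suc j) - h j) = h m - h 0" by (rule sum_lessThan_telescope)
  ultimately show ?thesis by (simp add: h_def)
qed

section \<open>Lower bound on the squared distance of two binomial distribution functions\<close>

definition binomial_cdf :: "nat \<Rightarrow> real \<Rightarrow> nat \<Rightarrow> real" where
  "binomial_cdf m p t = poisson_binomial (replicate m p) (\<lambda>c. of_bool (c \<le> t))"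

text \<open>Summation by parts: with \<open>f\<close> the partial sums of \<open>g\<close>, the left
  side is the difference of two expectations of \<open>f\<close>. The exchange formula applies to
  it, and the increments \<open>f (Suc c) - f c\<close> are \<open>g c\<close>.\<close>

lemma sum_weighted_binomial_cdf_diff:
  "(\<Sum>t<m. g t * (binomial_cdf m p t - binomial_cdf m q t)) =
     (q - p) * (\<Sum>j<m. poisson_binomial (replicate j q @ replicate (m - 1 - j) p) g)"
proof -
  define f where "f c = (\<Sum>t<c. g t)" for c
  have *: "(\<Sum>t<m. g t * binomial_cdf m s t) = f m - poisson_binomial (replicate m s) f" for s
  proof -
    have "(\<Sum>t<m. g t * binomial_cdf m s t) =
        poisson_binomial (replicate m s) (\<lambda>c. \<Sum>t<m. g t * of_bool (c \<le> t))"
      by (simp add: binomial_cdf_def poisson_binomial_sum poisson_binomial_cmult del: sum_mult_of_bool_eq)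
    also have "\<dots> = poisson_binomial (replicate m s) (\<lambda>c. f m - f c)"
    proof (rule poisson_binomial_cong)
      fix c assume "c \<le> length (replicate m s)"
      hence c: "c \<le> m" by simp
      have "f m = f c + (\<Sum>t=c..<m. g t)"
        unfolding f_def lessThan_atLeast0 using c by (simp add: sum.atLeastLessThan_concat)
      moreover have "(\<Sum>t<m. g t * of_bool (c \<le> t)) = (\<Sum>t=c..<m. g t)"
        by (intro sum.mono_neutral_cong_right) auto
      ultimately show "(\<Sum>t<m. g t * of_bool (c \<le> t)) = f m - f c" by simp
    qed
    finally show ?thesis by (simp add: poisson_binomial_diff poisson_binomial_const)
  qed
  have "(\<Sum>t<m. g t * (binomial_cdf m p t - binomial_cdf m q t)) =
      poisson_binomial (replicate m q) f - poisson_binomial (replicate m p) f"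
    using *[of p] *[of q] by (simp add: algebra_simps sum_subtractf)
  thus ?thesis unfolding poisson_binomial_exchange by (simp add: f_def)
qed

lemma card_nat_window:
  assumes "w \<ge> 0"
  shows "real (card {t \<in> {..<m}. \<bar>real t - a\<bar> \<le> w}) \<le> 2 * w + 1"
proof -
  have "int ` {t \<in> {..<m}. \<bar>real t - a\<bar> \<le> w} \<subseteq> {\<lceil>a - w\<rceil>..\<lfloor>a + w\<rfloor>}"
    by (auto simp: ceiling_le_iff le_floor_iff)
  hence "card (int ` {t \<in> {..<m}. \<bar>real t - a\<bar> \<le> w}) \<le> card {\<lceil>a - w\<rceil>..\<lfloor>a + w\<rfloor>}"
    by (intro card_mono) auto
  hence "card {t \<in> {..<m}. \<bar>real t - a\<bar> \<le> w} \<le> nat (\<lfloor>a + w\<rfloor> - \<lceil>a - w\<rceil> + 1)"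
    by (simp add: card_image)
  moreover have "real (nat (\<lfloor>a + w\<rfloor> - \<lceil>a - w\<rceil> + 1)) \<le> 2 * w + 1"
    using assms by linarith
  ultimately show ?thesis by linarith
qed

text \<open>The weight \<open>g\<close> is the indicator of a window that contains every hybrid sum
  of the exchange with probability at least 3/4, so the weighted sum of differences keeps 3/4 of the
  full shift \<open>m * (q - p)\<close>.\<close>

lemma binomial_cdf_distance_aux:
  assumes "0 \<le> p" "p \<le> q" "q \<le> 1"
  shows "(\<Sum>t<m. (binomial_cdf m p t - binomial_cdf m q t)\<^sup>2) \<ge>
    (m * (q - p))\<^sup>2 / (10 * (m * (q - p) + sqrt (m * (p + q)) + 1))"
proof -
  \<comment> \<open>\<open>a\<close> is the midpoint of the means \<open>m * p\<close> and
    \<open>m * q\<close>; \<open>v\<^sup>2\<close> bounds the mean of each hybrid and hence its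
    variance. The factor 2 in \<open>w\<close> makes Chebyshev fail with probability at most
    1/4.\<close>
  define a where "a = real m * (p + q) / 2"
  define v where "v = sqrt (m * (p + q))"
  define d where "d = m * (q - p)"
  define w where "w = 2 * (d / 2 + 1 + v)"
  define g where "g t = (of_bool (\<bar>real t - a\<bar> \<le> w) :: real)" for t :: nat
  define D where "D t = binomial_cdf m p t - binomial_cdf m q t" for t
  have v0: "v \<ge> 0" and d0: "d \<ge> 0" using assms by (simp_all add: v_def d_def)
  have w0: "w > 0" using v0 d0 by (simp add: w_def)
  have "poisson_binomial (replicate j q @ replicate (m - 1 - j) p) g \<ge> 3 / 4" if "j < m" for j
  proof -
    let ?ps = "replicate j q @ replicate (m - 1 - j) p"
    have s: "sum_list ?ps = j * q + (real m - 1 - j) * p"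
      using that by (simp add: sum_list_replicate of_nat_diff)
    have s1: "sum_list ?ps \<le> real m * q"
    proof -
      have "(real m - 1 - j) * p \<le> (real m - j) * q"
        using assms that by (intro mult_mono) auto
      thus ?thesis unfolding s by (simp add: algebra_simps)
    qed
    \<comment> \<open>A hybrid has only \<open>m - 1\<close> variables; the missing one costs at
      most \<open>p \<le> 1\<close>.\<close>
    have s2: "sum_list ?ps \<ge> real m * p - 1"
    proof -
      have "real j * q \<ge> real j * p" using assms by (intro mult_left_mono) auto
      thus ?thesis unfolding s using assms by (simp add: algebra_simps)
    qed
    have "\<bar>sum_list ?ps - a\<bar> \<le> d / 2 + 1"
    proof -
      have "a + d / 2 = real m * q" "a - d / 2 = real m * p"
        by (simp_all add: a_def d_def field_simps)
      thus ?thesis using s1 s2 by linarith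
    qed
    hence "(sum_list ?ps - a)\<^sup>2 \<le> (d / 2 + 1)\<^sup>2"
      by (metis abs_ge_zero power2_abs power_mono)
    moreover have "sum_list ?ps \<le> v\<^sup>2"
      using s1 assms by (simp add: v_def algebra_simps add_increasing)
    moreover have "(d / 2 + 1)\<^sup>2 + v\<^sup>2 \<le> (d / 2 + 1 + v)\<^sup>2"
      using v0 d0 by (simp add: power2_sum)
    moreover have "w\<^sup>2 / 4 = (d / 2 + 1 + v)\<^sup>2" unfolding w_def power_mult_distrib by simp
    ultimately have "(sum_list ?ps - a)\<^sup>2 + sum_list ?ps \<le> w\<^sup>2 / 4" by linarith
    hence "((sum_list ?ps - a)\<^sup>2 + sum_list ?ps) / w\<^sup>2 \<le> 1 / 4"
      using w0 by (simp add: field_simps)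
    moreover have "set ?ps \<subseteq> {0..1}" using assms by auto
    ultimately show ?thesis
      using poisson_binomial_chebyshev[OF _ w0, of ?ps a] unfolding g_def by linarith
  qed
  hence "(\<Sum>j<m. poisson_binomial (replicate j q @ replicate (m - 1 - j) p) g) \<ge> (\<Sum>j<m. 3 / 4)"
    by (intro sum_mono) auto
  hence "(q - p) * (\<Sum>j<m. 3 / 4) \<le> (\<Sum>t<m. g t * D t)"
    unfolding D_def sum_weighted_binomial_cdf_diff using assms by (intro mult_left_mono) auto
  hence "3 / 4 * d \<le> (\<Sum>t<m. g t * D t)" by (simp add: d_def algebra_simps)
  \<comment> \<open>Cauchy-Schwarz loses only the length of the window that carries most of the mean shift.\<close>
  hence "(3 / 4 * d)\<^sup>2 \<le> (\<Sum>t<m. g t * D t)\<^sup>2" using d0 by (intro power_mono) auto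
  also have "\<dots> \<le> (\<Sum>t<m. (g t)\<^sup>2) * (\<Sum>t<m. (D t)\<^sup>2)" by (rule Cauchy_Schwarz_ineq_sum)
  also have "(\<Sum>t<m. (g t)\<^sup>2) = real (card {t \<in> {..<m}. \<bar>real t - a\<bar> \<le> w})"
  proof -
    have "(g t)\<^sup>2 = of_bool (\<bar>real t - a\<bar> \<le> w)" for t by (simp add: g_def)
    thus ?thesis by (simp add: Int_def)
  qed
  also have "\<dots> * (\<Sum>t<m. (D t)\<^sup>2) \<le> (2 * w + 1) * (\<Sum>t<m. (D t)\<^sup>2)"
    using card_nat_window[of w m a] w0 by (intro mult_right_mono sum_nonneg) auto
  \<comment> \<open>Here \<open>2 * w + 1 = 2 * d + 4 * v + 5\<close>. Below,
    \<open>5 * 16 / 9 < 10\<close> yields the final constant.\<close>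
  also have "\<dots> \<le> (5 * (d + v + 1)) * (\<Sum>t<m. (D t)\<^sup>2)"
    using v0 d0 by (intro mult_right_mono sum_nonneg) (auto simp: w_def)
  finally have "9 / 16 * d\<^sup>2 \<le> 5 * ((d + v + 1) * (\<Sum>t<m. (D t)\<^sup>2))"
    by (simp only: power_mult_distrib mult.assoc) (simp add: power2_eq_square)
  moreover have "(d + v + 1) * (\<Sum>t<m. (D t)\<^sup>2) \<ge> 0"
    using v0 d0 by (intro mult_nonneg_nonneg sum_nonneg) auto
  ultimately have "d\<^sup>2 \<le> (10 * (d + v + 1)) * (\<Sum>t<m. (D t)\<^sup>2)"
    unfolding mult.assoc by linarith
  moreover have "10 * (d + v + 1) > 0" using v0 d0 by simp
  ultimately have "d\<^sup>2 / (10 * (d + v + 1)) \<le> (\<Sum>t<m. (D t)\<^sup>2)"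
    by (simp add: pos_divide_le_eq mult.commute)
  thus ?thesis unfolding D_def d_def v_def .
qed

lemma binomial_cdf_distance:
  assumes "p \<in> {0..1}" "q \<in> {0..1}"
  shows "(\<Sum>t<m. (binomial_cdf m p t - binomial_cdf m q t)\<^sup>2) \<ge>
    (m * \<bar>p - q\<bar>)\<^sup>2 / (10 * (m * \<bar>p - q\<bar> + sqrt (m * (p + q)) + 1))"
proof (cases "p \<le> q")
  case True
  thus ?thesis using binomial_cdf_distance_aux[of p q m] assms by (simp add: abs_if)
next
  case False
  thus ?thesis using binomial_cdf_distance_aux[of q p m] assms
    by (simp add: abs_if power2_commute add.commute)
qed

text \<open>Cauchy-Schwarz in Engel form (Sedrakyan), by splitting \<open>a i\<close> into
  \<open>sqrt (b i)\<close> and \<open>a i / sqrt (b i)\<close>.\<close>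

lemma sum_square_div_ge:
  fixes a b :: "'a \<Rightarrow> real"
  assumes "\<And>i. i \<in> I \<Longrightarrow> b i > 0"
  shows "(\<Sum>i\<in>I. a i)\<^sup>2 / (\<Sum>i\<in>I. b i) \<le> (\<Sum>i\<in>I. (a i)\<^sup>2 / b i)"
proof -
  have "(\<Sum>i\<in>I. a i)\<^sup>2 = (\<Sum>i\<in>I. sqrt (b i) * (a i / sqrt (b i)))\<^sup>2"
    using assms by (intro arg_cong[where f = "\<lambda>x. x\<^sup>2"] sum.cong) fastforce+
  also have "\<dots> \<le> (\<Sum>i\<in>I. (sqrt (b i))\<^sup>2) * (\<Sum>i\<in>I. (a i / sqrt (b i))\<^sup>2)"
    by (rule Cauchy_Schwarz_ineq_sum)
  also have "\<dots> = (\<Sum>i\<in>I. b i) * (\<Sum>i\<in>I. (a i)\<^sup>2 / b i)"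
    using assms by (intro arg_cong2[where f = "(*)"] sum.cong) (auto simp: power_divide less_imp_le)
  finally have *: "(\<Sum>i\<in>I. a i)\<^sup>2 \<le> (\<Sum>i\<in>I. b i) * (\<Sum>i\<in>I. (a i)\<^sup>2 / b i)" .
  have "(\<Sum>i\<in>I. b i) \<ge> 0" using assms by (intro sum_nonneg) (auto intro: less_imp_le)
  moreover have "(\<Sum>i\<in>I. (a i)\<^sup>2 / b i) \<ge> 0"
    using assms by (intro sum_nonneg divide_nonneg_nonneg) (auto intro: less_imp_le)
  \<comment> \<open>The denominator is 0 only for empty or infinite \<open>I\<close>; division by 0
    then makes the left side 0.\<close>
  ultimately show ?thesis
    using * by (cases "(\<Sum>i\<in>I. b i) = 0") (simp_all add: divide_le_eq mult.commute)
qed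

section \<open>The statistic\<close>

text \<open>Encoded by \<open>zip\<close> so that it recurses on both lists and is additive over
  blocks.\<close>

definition hamming :: "'a list \<Rightarrow> 'a list \<Rightarrow> nat" where
  "hamming u v = length (filter (\<lambda>(a, b). a \<noteq> b) (zip u v))"

lemma hamming_simps [simp]:
  "hamming [] v = 0" "hamming u [] = 0"
  "hamming (a # u) (b # v) = of_bool (a \<noteq> b) + hamming u v"
  by (simp_all add: hamming_def)

lemma hamming_self [simp]: "hamming u u = 0"
  by (induction u) simp_all

lemma hamming_take_drop:
  "hamming u v = hamming (take n u) (take n v) + hamming (drop n u) (drop n v)"
proof -
  have "zip u v = take n (zip u v) @ drop n (zip u v)" by simp
  hence "hamming u v = length (filter (\<lambda>(a, b). a \<noteq> b) (take n (zip u v) @ drop n (zip u v)))"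
    unfolding hamming_def by metis
  thus ?thesis by (simp add: hamming_def take_zip drop_zip del: append_take_drop_id)
qed

lemma differ_in_one_entry_hamming:
  "differ_in_one_entry u v \<longleftrightarrow> length u = length v \<and> hamming u v = 1"
  unfolding differ_in_one_entry_def hamming_def length_filter_conv_card
  by (auto intro!: arg_cong[where f = card] simp: conj_commute cong: conj_cong)

text \<open>Substituting one entry lowers one count by 1 and raises another by 1; this is the factor
  2.\<close>

lemma sum_count_list_diff:
  assumes "finite I" "length u = length v"
  shows "(\<Sum>i\<in>I. \<bar>real (count_list u i) - real (count_list v i)\<bar>) \<le> 2 * real (hamming u v)"
  using assms(2)
proof (induction u v rule: list_induct2)
  case (Cons a u b v)
  have one: "(\<Sum>i\<in>I. of_bool (x = i) :: real) \<le> 1" for x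
    using assms(1) by (simp add: of_bool_def)
  have "(\<Sum>i\<in>I. \<bar>real (count_list (a # u) i) - real (count_list (b # v) i)\<bar>) \<le>
      (\<Sum>i\<in>I. \<bar>real (count_list u i) - real (count_list v i)\<bar> +
        of_bool (a \<noteq> b) * (of_bool (a = i) + of_bool (b = i)))"
    by (intro sum_mono) auto
  also have "\<dots> = (\<Sum>i\<in>I. \<bar>real (count_list u i) - real (count_list v i)\<bar>) +
      of_bool (a \<noteq> b) * ((\<Sum>i\<in>I. of_bool (a = i)) + (\<Sum>i\<in>I. of_bool (b = i)))"
    by (simp only: sum.distrib flip: sum_distrib_left)
  also have "\<dots> \<le> 2 * real (hamming u v) + of_bool (a \<noteq> b) * (1 + 1)"
    by (intro add_mono Cons.IH mult_left_mono one) auto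
  finally show ?case by simp
qed simp

text \<open>The two step functions disagree exactly on \<open>{min a b..<max a b}\<close>, so
  summing over all thresholds costs no more than the change of the count.\<close>

lemma sum_threshold_diff:
  "(\<Sum>t<m. \<bar>of_bool (a \<le> t) - of_bool (b \<le> t)\<bar>) \<le> \<bar>real a - real b\<bar>"
proof -
  have "(\<Sum>t<m. \<bar>of_bool (a \<le> t) - of_bool (b \<le> t)\<bar> :: real) =
      (\<Sum>t<m. of_bool (t \<in> {min a b..<max a b}))"
    by (intro sum.cong) (auto simp: of_bool_def)
  also have "\<dots> = real (card ({..<m} \<inter> {min a b..<max a b}))"
    by (simp add: Int_def)
  also have "\<dots> \<le> real (card {min a b..<max a b})"
    by (intro of_nat_mono card_mono) auto
  also have "\<dots> = \<bar>real a - real b\<bar>" by auto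
  finally show ?thesis .
qed

primrec block_sum :: "nat \<Rightarrow> 'a \<Rightarrow> nat \<Rightarrow> nat \<Rightarrow> 'a list \<Rightarrow> real" where
  "block_sum m i t 0 u = 0"
| "block_sum m i t (Suc r) u =
     of_bool (count_list (take m u) i \<le> t) + block_sum m i t r (drop m u)"

lemma block_sum_bounds: "0 \<le> block_sum m i t r u" "block_sum m i t r u \<le> real r"
proof -
  have "0 \<le> block_sum m i t r u \<and> block_sum m i t r u \<le> real r"
    by (induction r arbitrary: u) (auto simp: add_increasing intro!: add_mono)
  thus "0 \<le> block_sum m i t r u" "block_sum m i t r u \<le> real r" by auto
qed

text \<open>An altered entry lies in at most one block, where it moves two counts by 1, and each of
  these crosses at most one threshold. Hence the bound is free of the numbers of symbols, thresholds
  and blocks.\<close>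

lemma block_sum_lipschitz:
  assumes "finite I" "length u = length v"
  shows "(\<Sum>i\<in>I. \<Sum>t<m. \<bar>block_sum m i t r u - block_sum m i t r v\<bar>) \<le> 2 * real (hamming u v)"
  using assms(2)
proof (induction r arbitrary: u v)
  case (Suc r)
  let ?d = "\<lambda>i t. \<bar>of_bool (count_list (take m u) i \<le> t) -
      of_bool (count_list (take m v) i \<le> t)\<bar> :: real"
  have "(\<Sum>i\<in>I. \<Sum>t<m. \<bar>block_sum m i t (Suc r) u - block_sum m i t (Suc r) v\<bar>) \<le>
      (\<Sum>i\<in>I. \<Sum>t<m. ?d i t + \<bar>block_sum m i t r (drop m u) - block_sum m i t r (drop m v)\<bar>)"
    unfolding block_sum.simps by (intro sum_mono) linarith
  also have "\<dots> = (\<Sum>i\<in>I. \<Sum>t<m. ?d i t) +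
      (\<Sum>i\<in>I. \<Sum>t<m. \<bar>block_sum m i t r (drop m u) - block_sum m i t r (drop m v)\<bar>)"
    by (simp only: sum.distrib)
  also have "\<dots> \<le> 2 * real (hamming (take m u) (take m v)) + 2 * real (hamming (drop m u) (drop m v))"
  proof (rule add_mono)
    have "(\<Sum>i\<in>I. \<Sum>t<m. ?d i t) \<le>
        (\<Sum>i\<in>I. \<bar>real (count_list (take m u) i) - real (count_list (take m v) i)\<bar>)"
      by (intro sum_mono sum_threshold_diff)
    also have "\<dots> \<le> 2 * real (hamming (take m u) (take m v))"
      using Suc.prems by (intro sum_count_list_diff assms(1)) auto
    finally show "(\<Sum>i\<in>I. \<Sum>t<m. ?d i t) \<le> 2 * real (hamming (take m u) (take m v))" .
  next
    show "(\<Sum>i\<in>I. \<Sum>t<m. \<bar>block_sum m i t r (drop m u) - block_sum m i t r (drop m v)\<bar>) \<le>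
        2 * real (hamming (drop m u) (drop m v))"
      using Suc.prems by (intro Suc.IH) auto
  qed
  also have "\<dots> = 2 * real (hamming u v)"
    by (subst (3) hamming_take_drop[of _ _ m]) simp
  finally show ?case .
qed simp

text \<open>Empirical distribution function of the number of occurrences of \<open>i\<close> per
  block.\<close>

definition block_cdf :: "nat \<Rightarrow> nat \<Rightarrow> 'a \<Rightarrow> nat \<Rightarrow> 'a list \<Rightarrow> real" where
  "block_cdf m r i t u = block_sum m i t r u / real r"

lemma block_cdf_bounds: "block_cdf m r i t u \<in> {0..1}"
  using block_sum_bounds[of m i t r u] by (cases "r = 0") (auto simp: block_cdf_def)

lemma block_cdf_lipschitz:
  assumes "finite I" "length u = length v"
  shows "(\<Sum>i\<in>I. \<Sum>t<m. \<bar>block_cdf m r i t u - block_cdf m r i t v\<bar>) \<le> 2 / r * hamming u v"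
proof -
  have "(\<Sum>i\<in>I. \<Sum>t<m. \<bar>block_cdf m r i t u - block_cdf m r i t v\<bar>) =
      (\<Sum>i\<in>I. \<Sum>t<m. \<bar>block_sum m i t r u - block_sum m i t r v\<bar>) / r"
    by (simp add: block_cdf_def sum_divide_distrib flip: diff_divide_distrib)
  also have "\<dots> \<le> 2 * real (hamming u v) / r"
    using block_sum_lipschitz[OF assms] by (intro divide_right_mono) auto
  finally show ?thesis by simp
qed

text \<open>For \<open>s = r = 1\<close> each sum over \<open>t\<close> is half of
  \<open>\<bar>X - Y\<bar> + \<bar>X' - Y'\<bar> - \<bar>X - X'\<bar> - \<bar>Y - Y'\<bar>\<close>, where \<open>X, X'\<close> and \<open>Y, Y'\<close> count the
  occurrences of \<open>i\<close> in the halves of the two samples.\<close>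

definition statistic :: "'a set \<Rightarrow> nat \<Rightarrow> nat \<Rightarrow> nat \<Rightarrow> 'a list \<Rightarrow> 'a list \<Rightarrow> real" where
  "statistic I m s r xs ys = (\<Sum>i\<in>I. \<Sum>t<m.
     (block_cdf m s i t (take (s * m) xs) - block_cdf m r i t (drop (r * m) ys)) *
     (block_cdf m s i t (drop (s * m) xs) - block_cdf m r i t (take (r * m) ys)))"

text \<open>Swapping the samples exchanges the two factors and flips both signs. This carries the
  sensitivity bound over to the second sample.\<close>

lemma statistic_commute: "statistic I m s r xs ys = statistic I m r s ys xs"
  unfolding statistic_def by (intro sum.cong refl) (simp add: algebra_simps)

text \<open>Each factor lies in \<open>[-1, 1]\<close>, so a product moves by at most the sum of the
  movements of its factors; the Hamming distances of the two halves add up to that of the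
  whole.\<close>

lemma statistic_lipschitz:
  assumes "finite I" "length xs = length xs'"
  shows "\<bar>statistic I m s r xs ys - statistic I m s r xs' ys\<bar> \<le> 2 / s * hamming xs xs'"
proof -
  let ?a = "\<lambda>i t xs. block_cdf m s i t (take (s * m) xs)"
  let ?b = "\<lambda>i t xs. block_cdf m s i t (drop (s * m) xs)"
  let ?c = "\<lambda>i t. block_cdf m r i t (take (r * m) ys)"
  let ?d = "\<lambda>i t. block_cdf m r i t (drop (r * m) ys)"
  have prod: "\<bar>(a - d) * (b - c) - (a' - d) * (b' - c)\<bar> \<le> \<bar>a - a'\<bar> + \<bar>b - b'\<bar>"
    if "{a, a', b, b', c, d} \<subseteq> {0..1}" for a a' b b' c d :: real
  proof -
    have "(a - d) * (b - c) - (a' - d) * (b' - c) = (a - a') * (b - c) + (a' - d) * (b - b')"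
      by (simp add: algebra_simps)
    also have "\<bar>\<dots>\<bar> \<le> \<bar>a - a'\<bar> * \<bar>b - c\<bar> + \<bar>a' - d\<bar> * \<bar>b - b'\<bar>"
      using abs_triangle_ineq[of "(a - a') * (b - c)" "(a' - d) * (b - b')"]
      by (simp add: abs_mult)
    also have "\<dots> \<le> \<bar>a - a'\<bar> * 1 + 1 * \<bar>b - b'\<bar>"
      using that by (intro add_mono mult_left_mono mult_right_mono) auto
    finally show ?thesis by simp
  qed
  have "\<bar>statistic I m s r xs ys - statistic I m s r xs' ys\<bar> =
      \<bar>\<Sum>i\<in>I. \<Sum>t<m. (?a i t xs - ?d i t) * (?b i t xs - ?c i t) -
        (?a i t xs' - ?d i t) * (?b i t xs' - ?c i t)\<bar>"
    by (simp add: statistic_def sum_subtractf)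
  also have "\<dots> \<le> (\<Sum>i\<in>I. \<Sum>t<m. \<bar>(?a i t xs - ?d i t) * (?b i t xs - ?c i t) -
        (?a i t xs' - ?d i t) * (?b i t xs' - ?c i t)\<bar>)"
    by (rule order.trans[OF sum_abs]) (intro sum_mono sum_abs)
  also have "\<dots> \<le> (\<Sum>i\<in>I. \<Sum>t<m. \<bar>?a i t xs - ?a i t xs'\<bar> + \<bar>?b i t xs - ?b i t xs'\<bar>)"
    by (intro sum_mono prod) (simp add: block_cdf_bounds[unfolded atLeastAtMost_iff])
  also have "\<dots> = (\<Sum>i\<in>I. \<Sum>t<m. \<bar>?a i t xs - ?a i t xs'\<bar>) +
      (\<Sum>i\<in>I. \<Sum>t<m. \<bar>?b i t xs - ?b i t xs'\<bar>)"
    by (simp only: sum.distrib)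
  also have "\<dots> \<le> 2 / s * hamming (take (s * m) xs) (take (s * m) xs') +
      2 / s * hamming (drop (s * m) xs) (drop (s * m) xs')"
    using assms by (intro add_mono block_cdf_lipschitz) auto
  also have "\<dots> = 2 / s * hamming xs xs'"
    unfolding hamming_take_drop[of xs xs' "s * m"] by (simp add: algebra_simps add_divide_distrib)
  finally show ?thesis .
qed

lemma statistic_lipschitz2:
  assumes "finite I" "length ys = length ys'"
  shows "\<bar>statistic I m s r xs ys - statistic I m s r xs ys'\<bar> \<le> 2 / r * hamming ys ys'"
  using statistic_lipschitz[OF assms] by (simp add: statistic_commute[of I m s r])

section \<open>Expectations and variances over independent samples of finite support\<close>

lemma expectation_bind_finite:
  fixes h :: "'b \<Rightarrow> real"
  assumes "finite (set_pmf p)" "\<And>x. x \<in> set_pmf p \<Longrightarrow> finite (set_pmf (f x))"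
  shows "measure_pmf.expectation (bind_pmf p f) h =
    measure_pmf.expectation p (\<lambda>x. measure_pmf.expectation (f x) h)"
  using assms
  by (subst pmf_expectation_bind[of "set_pmf p"])
     (auto simp: integral_measure_pmf_real[of "set_pmf p"] mult.commute)

lemma finite_set_replicate_pmf:
  assumes "finite (set_pmf p)"
  shows "finite (set_pmf (replicate_pmf n p))"
  using finite_lists_length_eq[OF assms, of n]
  by (simp add: set_replicate_pmf lists_eq_set)

lemma expectation_mono_finite:
  fixes f g :: "'a \<Rightarrow> real"
  assumes "finite (set_pmf p)" "\<And>x. x \<in> set_pmf p \<Longrightarrow> f x \<le> g x"
  shows "measure_pmf.expectation p f \<le> measure_pmf.expectation p g"
  using assms by (intro integral_mono_AE integrable_measure_pmf_finite AE_pmfI)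

lemma expectation_cong_pmf:
  fixes f g :: "'a \<Rightarrow> real"
  assumes "\<And>x. x \<in> set_pmf p \<Longrightarrow> f x = g x"
  shows "measure_pmf.expectation p f = measure_pmf.expectation p g"
  using assms by (intro integral_cong_AE AE_pmfI) auto

lemma expectation_replicate_Suc:
  fixes f :: "'a list \<Rightarrow> real"
  assumes "finite (set_pmf p)"
  shows "measure_pmf.expectation (replicate_pmf (Suc n) p) f =
    measure_pmf.expectation p (\<lambda>x. measure_pmf.expectation (replicate_pmf n p) (\<lambda>u. f (x # u)))"
  using assms
  by (simp add: expectation_bind_finite finite_set_replicate_pmf)

lemma expectation_replicate_add:
  fixes f :: "'a list \<Rightarrow> real"
  assumes "finite (set_pmf p)"
  shows "measure_pmf.expectation (replicate_pmf (m + n) p) f =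
    measure_pmf.expectation (replicate_pmf m p)
      (\<lambda>u. measure_pmf.expectation (replicate_pmf n p) (\<lambda>v. f (u @ v)))"
  using assms
  by (simp add: replicate_pmf_distrib expectation_bind_finite finite_set_replicate_pmf)

text \<open>Law of total variance: for fixed \<open>x\<close> the cross term averages to 0 over
  \<open>y\<close>, which leaves the conditional variance plus the squared deviation of the
  conditional mean.\<close>

lemma two_stage_variance:
  fixes h :: "'a \<Rightarrow> 'b \<Rightarrow> real"
  assumes P: "finite (set_pmf P)" and Q: "finite (set_pmf Q)"
    and A: "\<And>x. x \<in> set_pmf P \<Longrightarrow> measure_pmf.expectation Q
      (\<lambda>y. (h x y - measure_pmf.expectation Q (h x))\<^sup>2) \<le> a"
    and B: "measure_pmf.expectation P (\<lambda>x. (measure_pmf.expectation Q (h x) - \<mu>)\<^sup>2) \<le> b"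
  shows "measure_pmf.expectation P (\<lambda>x. measure_pmf.expectation Q (\<lambda>y. (h x y - \<mu>)\<^sup>2)) \<le> a + b"
proof -
  note int = integrable_measure_pmf_finite[OF P] integrable_measure_pmf_finite[OF Q]
  let ?g = "\<lambda>x. measure_pmf.expectation Q (h x)"
  have "measure_pmf.expectation Q (\<lambda>y. (h x y - \<mu>)\<^sup>2) \<le> a + (?g x - \<mu>)\<^sup>2"
    if "x \<in> set_pmf P" for x
  proof -
    have "(\<lambda>y. (h x y - \<mu>)\<^sup>2) =
        (\<lambda>y. (h x y - ?g x)\<^sup>2 + 2 * (?g x - \<mu>) * (h x y - ?g x) + (?g x - \<mu>)\<^sup>2)"
      by (simp add: fun_eq_iff power2_eq_square algebra_simps)
    hence "measure_pmf.expectation Q (\<lambda>y. (h x y - \<mu>)\<^sup>2) =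
        measure_pmf.expectation Q (\<lambda>y. (h x y - ?g x)\<^sup>2) + (?g x - \<mu>)\<^sup>2"
      by (simp add: int)
    thus ?thesis using A[OF that] by simp
  qed
  hence "measure_pmf.expectation P (\<lambda>x. measure_pmf.expectation Q (\<lambda>y. (h x y - \<mu>)\<^sup>2)) \<le>
      measure_pmf.expectation P (\<lambda>x. a + (?g x - \<mu>)\<^sup>2)"
    by (intro expectation_mono_finite P)
  also have "\<dots> = a + measure_pmf.expectation P (\<lambda>x. (?g x - \<mu>)\<^sup>2)" by (simp add: int)
  finally show ?thesis using B by simp
qed

lemma expectation_diff_le:
  fixes f :: "'a \<Rightarrow> real"
  assumes "finite (set_pmf p)" "\<And>x. x \<in> set_pmf p \<Longrightarrow> \<bar>f x - c\<bar> \<le> L"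
  shows "\<bar>measure_pmf.expectation p f - c\<bar> \<le> L"
proof -
  have "f x \<le> c + L \<and> c - L \<le> f x" if "x \<in> set_pmf p" for x
    using assms(2)[OF that] by linarith
  hence "measure_pmf.expectation p f \<le> measure_pmf.expectation p (\<lambda>x. c + L)"
    "measure_pmf.expectation p (\<lambda>x. c - L) \<le> measure_pmf.expectation p f"
    by (intro expectation_mono_finite assms(1); simp)+
  thus ?thesis by simp
qed

text \<open>Efron-Stein for bounded differences, revealing the first entry: given it, the induction
  hypothesis bounds the variance over the tail, and the conditional mean adds at most
  \<open>L\<^sup>2\<close>.\<close>

lemma lipschitz_variance:
  fixes f :: "'a list \<Rightarrow> real"
  assumes p: "finite (set_pmf p)"
    and L: "\<And>u v. length u = length v \<Longrightarrow> hamming u v \<le> 1 \<Longrightarrow> \<bar>f u - f v\<bar> \<le> L"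
  shows "measure_pmf.expectation (replicate_pmf n p)
    (\<lambda>u. (f u - measure_pmf.expectation (replicate_pmf n p) f)\<^sup>2) \<le> n * L\<^sup>2"
  using L
proof (induction n arbitrary: f)
  case (Suc n)
  let ?P = "replicate_pmf n p"
  let ?g = "\<lambda>x. measure_pmf.expectation ?P (\<lambda>u. f (x # u))"
  define \<mu> where "\<mu> = measure_pmf.expectation p ?g"
  have fin: "finite (set_pmf ?P)" by (rule finite_set_replicate_pmf[OF p])
  have "measure_pmf.expectation p (\<lambda>x. measure_pmf.expectation ?P (\<lambda>u. (f (x # u) - \<mu>)\<^sup>2)) \<le>
      n * L\<^sup>2 + L\<^sup>2"
  proof (rule two_stage_variance[OF p fin])
    fix x
    show "measure_pmf.expectation ?P (\<lambda>u. (f (x # u) - ?g x)\<^sup>2) \<le> n * L\<^sup>2"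
      by (rule Suc.IH) (simp add: Suc.prems)
  next
    \<comment> \<open>Coupling: both conditional means use the same tail \<open>u\<close>, and
      \<open>x # u\<close> and \<open>y # u\<close> differ in at most one place.\<close>
    have "\<bar>?g x - ?g y\<bar> \<le> L" for x y
    proof -
      have "?g x - ?g y = measure_pmf.expectation ?P (\<lambda>u. f (x # u) - f (y # u))"
        by (simp add: integrable_measure_pmf_finite[OF fin])
      thus ?thesis
        using expectation_diff_le[OF fin, of "\<lambda>u. f (x # u) - f (y # u)" 0 L] Suc.prems by simp
    qed
    hence "\<bar>\<mu> - ?g x\<bar> \<le> L" for x
      unfolding \<mu>_def by (rule expectation_diff_le[OF p])
    hence "(?g x - \<mu>)\<^sup>2 \<le> L\<^sup>2" for x
      by (metis abs_ge_zero abs_minus_commute power2_abs power_mono)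
    hence "measure_pmf.expectation p (\<lambda>x. (?g x - \<mu>)\<^sup>2) \<le> measure_pmf.expectation p (\<lambda>x. L\<^sup>2)"
      by (intro expectation_mono_finite p)
    thus "measure_pmf.expectation p (\<lambda>x. (?g x - \<mu>)\<^sup>2) \<le> L\<^sup>2" by simp
  qed
  thus ?case
    unfolding expectation_replicate_Suc[OF p] \<mu>_def by (simp add: algebra_simps)
qed simp

section \<open>Mean and variance of the statistic\<close>

lemma expectation_count_list:
  assumes p: "finite (set_pmf p)"
  shows "measure_pmf.expectation (replicate_pmf m p) (\<lambda>u. f (count_list u i)) =
    poisson_binomial (replicate m (pmf p i)) f"
proof (induction m arbitrary: f)
  case (Suc m)
  let ?B = "\<lambda>f. poisson_binomial (replicate m (pmf p i)) f"
  have "measure_pmf.expectation (replicate_pmf (Suc m) p) (\<lambda>u. f (count_list u i)) =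
      measure_pmf.expectation p (\<lambda>x. if x = i then ?B (\<lambda>c. f (Suc c)) else ?B f)"
    unfolding expectation_replicate_Suc[OF p]
    by (intro Bochner_Integration.integral_cong refl) (simp add: Suc.IH[symmetric])
  also have "\<dots> = measure_pmf.expectation p
      (\<lambda>x. ?B f + (?B (\<lambda>c. f (Suc c)) - ?B f) * indicator {i} x)"
    by (intro Bochner_Integration.integral_cong) auto
  also have "\<dots> = ?B f + (?B (\<lambda>c. f (Suc c)) - ?B f) * pmf p i"
    by (simp add: integrable_measure_pmf_finite[OF p] measure_pmf_single)
  finally show ?case by (simp add: algebra_simps)
qed simp

lemma expectation_block_sum:
  assumes p: "finite (set_pmf p)"
  shows "measure_pmf.expectation (replicate_pmf (r * m) p) (block_sum m i t r) =
    r * binomial_cdf m (pmf p i) t"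
proof (induction r)
  case (Suc r)
  let ?P = "replicate_pmf m p" and ?Q = "replicate_pmf (r * m) p"
  note int = integrable_measure_pmf_finite[OF finite_set_replicate_pmf[OF p]]
  have "measure_pmf.expectation (replicate_pmf (Suc r * m) p) (block_sum m i t (Suc r)) =
      measure_pmf.expectation ?P (\<lambda>u. measure_pmf.expectation ?Q
        (\<lambda>v. block_sum m i t (Suc r) (u @ v)))"
    unfolding mult_Suc by (rule expectation_replicate_add[OF p])
  also have "\<dots> = measure_pmf.expectation ?P (\<lambda>u. measure_pmf.expectation ?Q
        (\<lambda>v. of_bool (count_list u i \<le> t) + block_sum m i t r v))"
    by (rule expectation_cong_pmf) (simp add: set_replicate_pmf)
  also have "\<dots> = measure_pmf.expectation ?P (\<lambda>u. of_bool (count_list u i \<le> t)) +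
      r * binomial_cdf m (pmf p i) t"
    by (simp add: int Suc.IH)
  also have "measure_pmf.expectation ?P (\<lambda>u. of_bool (count_list u i \<le> t)) =
      binomial_cdf m (pmf p i) t"
    unfolding binomial_cdf_def by (rule expectation_count_list[OF p])
  finally show ?case by (simp add: algebra_simps)
qed simp

lemma expectation_block_cdf:
  assumes "finite (set_pmf p)" "r > 0"
  shows "measure_pmf.expectation (replicate_pmf (r * m) p) (block_cdf m r i t) =
    binomial_cdf m (pmf p i) t"
  using expectation_block_sum[OF assms(1), of r m i t] assms(2)
  by (simp add: block_cdf_def[abs_def])

text \<open>The two factors of each product use disjoint halves of both samples, so they are
  independent with equal means and the product has the squared mean. Squaring a single estimate
  would add its variance.\<close>

lemma expectation_statistic:
  assumes p: "finite (set_pmf p)" and q: "finite (set_pmf q)" and "s > 0" "r > 0" "finite I"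
  shows "measure_pmf.expectation (replicate_pmf (2 * (s * m)) p) (\<lambda>xs.
      measure_pmf.expectation (replicate_pmf (2 * (r * m)) q) (statistic I m s r xs)) =
    (\<Sum>i\<in>I. \<Sum>t<m. (binomial_cdf m (pmf p i) t - binomial_cdf m (pmf q i) t)\<^sup>2)"
proof -
  let ?P = "replicate_pmf (s * m) p" and ?Q = "replicate_pmf (r * m) q"
  note int = integrable_measure_pmf_finite[OF finite_set_replicate_pmf[OF p]]
    integrable_measure_pmf_finite[OF finite_set_replicate_pmf[OF q]]
  let ?a = "block_cdf m s" and ?b = "block_cdf m r"
  have "measure_pmf.expectation (replicate_pmf (2 * (s * m)) p) (\<lambda>xs.
      measure_pmf.expectation (replicate_pmf (2 * (r * m)) q) (statistic I m s r xs)) =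
    measure_pmf.expectation ?P (\<lambda>u. measure_pmf.expectation ?P (\<lambda>u'.
      measure_pmf.expectation ?Q (\<lambda>v. measure_pmf.expectation ?Q (\<lambda>v'.
        statistic I m s r (u @ u') (v @ v')))))"
    unfolding mult_2 expectation_replicate_add[OF p] expectation_replicate_add[OF q] ..
  also have "\<dots> = measure_pmf.expectation ?P (\<lambda>u. measure_pmf.expectation ?P (\<lambda>u'.
      measure_pmf.expectation ?Q (\<lambda>v. measure_pmf.expectation ?Q (\<lambda>v'.
        \<Sum>i\<in>I. \<Sum>t<m. (?a i t u - ?b i t v') * (?a i t u' - ?b i t v)))))"
    by (intro expectation_cong_pmf) (simp add: set_replicate_pmf statistic_def)
  also have "\<dots> = (\<Sum>i\<in>I. \<Sum>t<m.
      (binomial_cdf m (pmf p i) t - binomial_cdf m (pmf q i) t)\<^sup>2)"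
    using assms by (simp add: int expectation_block_cdf power2_eq_square)
  finally show ?thesis .
qed

text \<open>The second sample has \<open>2 * (r * m)\<close> entries of influence
  \<open>2 / r\<close>, contributing \<open>2 * (r * m) * (2 / r)\<^sup>2 = 8 * m / r\<close>;
  likewise the first with \<open>s\<close>.\<close>

lemma variance_statistic:
  fixes m s r :: nat
  assumes p: "finite (set_pmf p)" and q: "finite (set_pmf q)" and "s > 0" "r > 0" "finite I"
  defines "P \<equiv> replicate_pmf (2 * (s * m)) p" and "Q \<equiv> replicate_pmf (2 * (r * m)) q"
  defines "\<mu> \<equiv> measure_pmf.expectation P (\<lambda>xs. measure_pmf.expectation Q (statistic I m s r xs))"
  shows "measure_pmf.expectation P (\<lambda>xs. measure_pmf.expectation Q (\<lambda>ys.
    (statistic I m s r xs ys - \<mu>)\<^sup>2)) \<le> 8 * real m / r + 8 * real m / s"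
proof (rule two_stage_variance)
  show fin: "finite (set_pmf P)" "finite (set_pmf Q)"
    using p q by (simp_all add: P_def Q_def finite_set_replicate_pmf)
  have eq: "real (2 * (l * m)) * (2 / real l)\<^sup>2 = 8 * real m / real l" if "l > 0" for l
    using that by (simp add: field_simps power2_eq_square)
  have le: "2 / real l * real h \<le> 2 / real l" if "h \<le> 1" for h l :: nat
    using that by (intro mult_left_le) auto
  show "measure_pmf.expectation Q (\<lambda>ys. (statistic I m s r xs ys -
      measure_pmf.expectation Q (statistic I m s r xs))\<^sup>2) \<le> 8 * real m / r" for xs
    unfolding Q_def eq[OF \<open>r > 0\<close>, symmetric]
    by (intro lipschitz_variance q)
       (use le statistic_lipschitz2[OF \<open>finite I\<close>] order.trans in blast)
  have "\<bar>measure_pmf.expectation Q (statistic I m s r xs) -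
      measure_pmf.expectation Q (statistic I m s r xs')\<bar> \<le> 2 / s"
    if "length xs = length xs'" "hamming xs xs' \<le> 1" for xs xs'
  proof -
    have "\<bar>statistic I m s r xs ys - statistic I m s r xs' ys\<bar> \<le> 2 / s" for ys
      using le[OF that(2), of s] statistic_lipschitz[OF \<open>finite I\<close> that(1)] order.trans by blast
    hence "\<bar>measure_pmf.expectation Q
        (\<lambda>ys. statistic I m s r xs ys - statistic I m s r xs' ys) - 0\<bar> \<le> 2 / s"
      by (intro expectation_diff_le fin) auto
    thus ?thesis by (simp add: integrable_measure_pmf_finite[OF fin(2)])
  qed
  thus "measure_pmf.expectation P
      (\<lambda>xs. (measure_pmf.expectation Q (statistic I m s r xs) - \<mu>)\<^sup>2) \<le> 8 * real m / s"
    unfolding \<mu>_def P_def eq[OF \<open>s > 0\<close>, symmetric] by (intro lipschitz_variance p) auto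
qed

text \<open>The bounds for the single symbols are combined by Cauchy-Schwarz in Engel form. The
  denominators sum up well because \<open>\<Sum> c i = 2 * m\<close> gives
  \<open>\<Sum> sqrt (c i) \<le> sqrt (2 * (m * k))\<close>.\<close>

lemma statistic_mean_ge:
  fixes p q :: "nat pmf"
  assumes "set_pmf p \<subseteq> {1..k}" "set_pmf q \<subseteq> {1..k}" "dist_TV k p q \<ge> \<alpha>" "\<alpha> > 0" "m > 0" "k > 0"
  shows "(\<Sum>i\<in>{1..k}. \<Sum>t<m. (binomial_cdf m (pmf p i) t - binomial_cdf m (pmf q i) t)\<^sup>2) \<ge>
    (m * \<alpha>)\<^sup>2 / (5 * (m * \<alpha> + sqrt (m * k) + k))"
proof -
  define a where "a i = m * \<bar>pmf p i - pmf q i\<bar>" for i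
  define c where "c i = m * (pmf p i + pmf q i)" for i
  define b where "b i = 10 * (a i + sqrt (c i) + 1)" for i
  define x where "x = (\<Sum>i\<in>{1..k}. a i)"
  define y where "y = 2 * (m * \<alpha>)"
  define B where "B = sqrt (2 * (m * k)) + k"
  have a0: "a i \<ge> 0" and c0: "c i \<ge> 0" for i by (simp_all add: a_def c_def)
  have "x = m * (2 * dist_TV k p q)" by (simp add: x_def a_def dist_TV_def sum_distrib_left)
  hence xy: "y \<le> x" using assms by (simp add: y_def)
  have y0: "y > 0" using assms by (simp add: y_def)
  have B0: "B > 0" using assms by (simp add: B_def add_nonneg_pos)
  have sum_c: "(\<Sum>i\<in>{1..k}. c i) = 2 * m"
    using sum_pmf_eq_1[of "{1..k}" p] sum_pmf_eq_1[of "{1..k}" q] assms(1,2)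
    by (simp add: c_def sum.distrib flip: sum_distrib_left)
  have "(\<Sum>i\<in>{1..k}. sqrt (c i) * 1)\<^sup>2 \<le>
      (\<Sum>i\<in>{1..k}. (sqrt (c i))\<^sup>2) * (\<Sum>i\<in>{1..k}. 1\<^sup>2)"
    by (rule Cauchy_Schwarz_ineq_sum)
  also have "\<dots> = 2 * (m * k)" using c0 sum_c by simp
  finally have "(\<Sum>i\<in>{1..k}. sqrt (c i)) \<le> sqrt (2 * (m * k))"
    by (intro real_le_rsqrt) simp
  hence sum_b: "(\<Sum>i\<in>{1..k}. b i) \<le> 10 * (x + B)"
    by (simp add: b_def B_def x_def sum.distrib flip: sum_distrib_left)
  have b0: "b i > 0" for i using a0[of i] c0[of i] by (simp add: b_def add_nonneg_pos)
  have "sqrt (2 * (m * k)) \<le> 2 * sqrt (m * k)"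
    by (intro real_le_lsqrt) (auto simp: power_mult_distrib)
  hence "y + B \<le> 2 * (m * \<alpha> + sqrt (m * k) + k)" by (simp add: y_def B_def)
  \<comment> \<open>The factor 2 between \<open>\<ell>\<^sub>1\<close> and total variation, squared
    in \<open>y\<^sup>2\<close>, turns the constant 20 into 5.\<close>
  hence "y\<^sup>2 / (10 * (2 * (m * \<alpha> + sqrt (m * k) + k))) \<le> y\<^sup>2 / (10 * (y + B))"
    using y0 B0 by (intro divide_left_mono mult_left_mono mult_pos_pos) auto
  moreover have "y\<^sup>2 / (10 * (2 * S)) = (m * \<alpha>)\<^sup>2 / (5 * S)" for S
    unfolding y_def power_mult_distrib by simp
  ultimately have "(m * \<alpha>)\<^sup>2 / (5 * (m * \<alpha> + sqrt (m * k) + k)) \<le> y\<^sup>2 / (10 * (y + B))"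
    by metis
  \<comment> \<open>\<open>x\<^sup>2 / (x + B)\<close> increases with \<open>x > 0\<close>; after
    cross-multiplication the difference has the factor \<open>x - y\<close>.\<close>
  also have "\<dots> \<le> x\<^sup>2 / (10 * (x + B))"
  proof -
    have "y\<^sup>2 * (x + B) \<le> x\<^sup>2 * (y + B)"
    proof -
      have "x\<^sup>2 * (y + B) - y\<^sup>2 * (x + B) = (x - y) * (x * y + B * (x + y))"
        by (simp add: algebra_simps power2_eq_square)
      also have "\<dots> \<ge> 0" using xy y0 B0 by (intro mult_nonneg_nonneg add_nonneg_nonneg) auto
      finally show ?thesis by simp
    qed
    thus ?thesis using xy y0 B0 by (simp add: divide_simps algebra_simps)
  qed
  also have "\<dots> \<le> x\<^sup>2 / (\<Sum>i\<in>{1..k}. b i)"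
    using sum_b b0 xy y0 B0 assms(6)
    by (intro divide_left_mono mult_pos_pos sum_pos) auto
  also have "\<dots> \<le> (\<Sum>i\<in>{1..k}. (a i)\<^sup>2 / b i)"
    unfolding x_def by (rule sum_square_div_ge) (rule b0)
  also have "\<dots> \<le> (\<Sum>i\<in>{1..k}. \<Sum>t<m.
      (binomial_cdf m (pmf p i) t - binomial_cdf m (pmf q i) t)\<^sup>2)"
    unfolding a_def b_def c_def
    by (intro sum_mono binomial_cdf_distance) (auto simp: pmf_le_1)
  finally show ?thesis unfolding of_nat_mult .
qed

section \<open>The private tester\<close>

definition logistic :: "real \<Rightarrow> real" where
  "logistic u = 1 / (1 + exp (- u))"

lemma logistic_bounds: "logistic u \<in> {0..1}"
  by (auto simp: logistic_def add_nonneg_nonneg divide_le_eq_1 add_pos_pos)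

lemma logistic_minus: "logistic (- u) = 1 - logistic u"
proof -
  have "1 + exp u \<noteq> 0" using exp_gt_zero[of u] by linarith
  thus ?thesis by (simp add: logistic_def exp_minus field_simps)
qed

lemma logistic_mono: "u \<le> v \<Longrightarrow> logistic u \<le> logistic v"
  unfolding logistic_def by (intro divide_left_mono add_left_mono mult_pos_pos add_pos_pos) auto

text \<open>This says that \<open>ln (logistic u)\<close> is 1-Lipschitz in \<open>u\<close>; the
  denominators are compared term by term.\<close>

lemma logistic_le_exp:
  assumes "\<bar>u - v\<bar> \<le> \<epsilon>"
  shows "logistic u \<le> exp \<epsilon> * logistic v"
proof -
  have "1 \<le> exp \<epsilon>" using assms by simp
  moreover have "exp (- v) \<le> exp \<epsilon> * exp (- u)" using assms by (simp flip: exp_add)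
  ultimately have "1 + exp (- v) \<le> exp \<epsilon> * (1 + exp (- u))"
    unfolding distrib_left mult_1_right by linarith
  thus ?thesis unfolding logistic_def by (simp add: divide_simps add_pos_pos add_eq_0_iff)
qed

lemma logistic_le_sixth:
  assumes "u \<le> - 2"
  shows "logistic u \<le> 1 / 6"
proof -
  have "exp (2::real) \<ge> 5" using exp_lower_Taylor_quadratic[of 2] by simp
  also have "exp 2 \<le> exp (- u)" using assms by simp
  finally show ?thesis by (simp add: logistic_def divide_simps add_pos_pos)
qed

definition random_verdict :: "real \<Rightarrow> verdict pmf" where
  "random_verdict x = map_pmf (\<lambda>b. if b then Reject else Accept) (bernoulli_pmf x)"

lemma prob_random_verdict:
  assumes "x \<in> {0..1}"
  shows "measure_pmf.prob (random_verdict x) S =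
    of_bool (Reject \<in> S) * x + of_bool (Accept \<in> S) * (1 - x)"
proof -
  have "measure_pmf.prob (random_verdict x) S =
      measure_pmf.expectation (bernoulli_pmf x) (indicator {b. (if b then Reject else Accept) \<in> S})"
    by (simp add: random_verdict_def vimage_def)
  also have "\<dots> = of_bool (Reject \<in> S) * x + of_bool (Accept \<in> S) * (1 - x)"
    using assms by (subst integral_bernoulli_pmf) (auto simp: indicator_def)
  finally show ?thesis .
qed

text \<open>Acceptance has probability \<open>logistic (- u)\<close>, so one Lipschitz bound covers
  both verdicts, and the bounds add up over \<open>S\<close>.\<close>

lemma random_verdict_logistic_private:
  assumes "\<bar>u - v\<bar> \<le> \<epsilon>"
  shows "measure_pmf.prob (random_verdict (logistic u)) S \<le>
    exp \<epsilon> * measure_pmf.prob (random_verdict (logistic v)) S"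
proof -
  have "logistic (- u) \<le> exp \<epsilon> * logistic (- v)"
    using assms by (intro logistic_le_exp) auto
  moreover have "logistic u \<le> exp \<epsilon> * logistic v" by (rule logistic_le_exp[OF assms])
  moreover have "0 \<le> \<epsilon>" using assms by simp
  ultimately show ?thesis
    by (simp add: prob_random_verdict logistic_bounds[unfolded atLeastAtMost_iff] logistic_minus
        algebra_simps)
qed

text \<open>The first sample has one block per half, the second has \<open>r\<close>. The slope
  \<open>c\<close> governs the privacy loss.\<close>

definition tester :: "'a set \<Rightarrow> nat \<Rightarrow> nat \<Rightarrow> real \<Rightarrow> real \<Rightarrow> 'a list \<Rightarrow> 'a list \<Rightarrow> verdict pmf" where
  "tester I m r c \<tau> xs ys = random_verdict (logistic (c * (statistic I m 1 r xs ys - \<tau>)))"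

lemma tester_private_to_first:
  assumes "c \<ge> 0" "2 * c \<le> \<epsilon>" "finite I"
  shows "private_to_first k \<epsilon> n1 n2 (tester I m r c \<tau>)"
  unfolding private_to_first_def differentially_private_def differ_in_one_entry_hamming tester_def
proof (intro ballI allI impI random_verdict_logistic_private)
  fix xs xs' ys :: "nat list"
  assume "length xs = length xs' \<and> hamming xs xs' = 1"
  hence "\<bar>statistic I m 1 r xs ys - statistic I m 1 r xs' ys\<bar> \<le> 2"
    using statistic_lipschitz[OF assms(3), of xs xs' m 1 r ys] by simp
  hence "c * \<bar>statistic I m 1 r xs ys - statistic I m 1 r xs' ys\<bar> \<le> c * 2"
    using assms(1) by (rule mult_left_mono)
  thus "\<bar>c * (statistic I m 1 r xs ys - \<tau>) - c * (statistic I m 1 r xs' ys - \<tau>)\<bar> \<le> \<epsilon>"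
    using assms by (simp add: abs_mult flip: right_diff_distrib)
qed

lemma tester_private_to_second:
  assumes "c \<ge> 0" "2 * c / r \<le> \<epsilon>" "finite I"
  shows "private_to_second k \<epsilon> n1 n2 (tester I m r c \<tau>)"
  unfolding private_to_second_def differentially_private_def differ_in_one_entry_hamming tester_def
proof (intro ballI allI impI random_verdict_logistic_private)
  fix xs ys ys' :: "nat list"
  assume "length ys = length ys' \<and> hamming ys ys' = 1"
  hence "\<bar>statistic I m 1 r xs ys - statistic I m 1 r xs ys'\<bar> \<le> 2 / r"
    using statistic_lipschitz2[OF assms(3), of ys ys' m 1 r xs] by simp
  hence "c * \<bar>statistic I m 1 r xs ys - statistic I m 1 r xs ys'\<bar> \<le> c * (2 / r)"
    using assms(1) by (rule mult_left_mono)
  thus "\<bar>c * (statistic I m 1 r xs ys - \<tau>) - c * (statistic I m 1 r xs ys' - \<tau>)\<bar> \<le> \<epsilon>"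
    using assms by (simp add: abs_mult mult.commute flip: right_diff_distrib)
qed

section \<open>Error probabilities of the tester\<close>

text \<open>Both sources of error in one pointwise bound: for \<open>z \<le> \<tau> / 2\<close> the
  coin errs with probability at most 1/6, otherwise the quadratic term alone reaches 1. In
  expectation only the variance remains to be bounded.\<close>

lemma logistic_tail:
  assumes "\<tau> > 0" "c * \<tau> \<ge> 4" "\<mu> \<le> 0"
  shows "logistic (c * (z - \<tau>)) \<le> 1 / 6 + 4 / \<tau>\<^sup>2 * (z - \<mu>)\<^sup>2"
proof (cases "z \<le> \<tau> / 2")
  case True
  have "c > 0" using assms by (metis mult_less_cancel_right2 not_numeral_le_zero order.strict_trans2
        zero_less_mult_pos2 zero_less_numeral)
  hence "c * (z - \<tau>) \<le> c * (- \<tau> / 2)" using True by (intro mult_left_mono) auto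
  also have "\<dots> \<le> - 2" using assms by simp
  finally have "logistic (c * (z - \<tau>)) \<le> 1 / 6" by (rule logistic_le_sixth)
  thus ?thesis by (simp add: add_increasing2)
next
  case False
  hence "(\<tau> / 2)\<^sup>2 \<le> (z - \<mu>)\<^sup>2" using assms by (intro power_mono) auto
  hence "1 \<le> 4 / \<tau>\<^sup>2 * (z - \<mu>)\<^sup>2" using assms by (simp add: field_simps)
  moreover have "logistic (c * (z - \<tau>)) \<le> 1" using logistic_bounds by simp
  ultimately show ?thesis by linarith
qed

lemma prob_run_tester:
  fixes p q :: "'a pmf"
  assumes p: "finite (set_pmf p)" and q: "finite (set_pmf q)"
  shows "measure_pmf.prob (run_on_samples n1 n2 (tester I m r c \<tau>) p q) S =
    measure_pmf.expectation (replicate_pmf n1 p) (\<lambda>xs. measure_pmf.expectation (replicate_pmf n2 q)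
      (\<lambda>ys. measure_pmf.prob (tester I m r c \<tau> xs ys) S))"
proof -
  have fin: "finite (set_pmf M)" for M :: "verdict pmf"
    by (rule finite_subset[of _ "{Accept, Reject}"]) (use verdict.exhaust in auto)
  have "measure_pmf.prob M S = measure_pmf.expectation M (indicator S)" for M :: "verdict pmf"
    by simp
  thus ?thesis
    unfolding run_on_samples_def
    by (simp only: expectation_bind_finite finite_set_replicate_pmf p q fin)
qed

text \<open>The mean is 0 for equal distributions and at least \<open>2 * \<tau>\<close> for distant
  ones, so \<open>\<tau>\<close> separates the cases. Coin and fluctuation each contribute at most
  1/6 to the error.\<close>

lemma closeness_tester_tester:
  assumes "r > 0" "m > 0" "k > 0" "\<alpha> > 0" "\<tau> > 0" "c * \<tau> \<ge> 4" "384 * m \<le> \<tau>\<^sup>2"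
    and gap: "2 * \<tau> \<le> (m * \<alpha>)\<^sup>2 / (5 * (m * \<alpha> + sqrt (m * k) + k))"
  shows "closeness_tester k \<alpha> (2 * m) (2 * (r * m)) (tester {1..k} m r c \<tau>)"
  unfolding closeness_tester_def
proof (intro allI impI conjI)
  fix p q :: "nat pmf"
  assume supp: "set_pmf p \<subseteq> {1..k}" "set_pmf q \<subseteq> {1..k}"
  have p: "finite (set_pmf p)" and q: "finite (set_pmf q)"
    using supp finite_subset by blast+
  let ?P = "replicate_pmf (2 * m) p" and ?Q = "replicate_pmf (2 * (r * m)) q"
  let ?E = "\<lambda>h. measure_pmf.expectation ?P (\<lambda>xs. measure_pmf.expectation ?Q (h xs)) :: real"
  have P: "finite (set_pmf ?P)" and Q: "finite (set_pmf ?Q)"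
    by (simp_all add: finite_set_replicate_pmf p q)
  let ?Z = "statistic {1..k} m 1 r"
  define \<mu> where "\<mu> = ?E ?Z"
  have \<mu>: "\<mu> = (\<Sum>i\<in>{1..k}. \<Sum>t<m.
      (binomial_cdf m (pmf p i) t - binomial_cdf m (pmf q i) t)\<^sup>2)"
    unfolding \<mu>_def using expectation_statistic[OF p q, of 1 r "{1..k}" m] assms(1) by simp
  have "?E (\<lambda>xs ys. (?Z xs ys - \<mu>)\<^sup>2) \<le> 8 * real m / r + 8 * real m / 1"
    unfolding \<mu>_def using variance_statistic[OF p q, of 1 r "{1..k}" m] assms(1) by simp
  also have "\<dots> \<le> 16 * real m"
  proof -
    have "8 * real m / real r \<le> 8 * real m / 1" using assms(1) by (intro divide_left_mono) auto
    thus ?thesis by simp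
  qed
  finally have var: "?E (\<lambda>xs ys. (?Z xs ys - \<mu>)\<^sup>2) \<le> 16 * real m" .
  have third: "?E h \<le> 1 / 3"
    if "\<And>xs ys. h xs ys \<le> 1 / 6 + 4 / \<tau>\<^sup>2 * (?Z xs ys - \<mu>)\<^sup>2" for h
  proof -
    have "?E h \<le> ?E (\<lambda>xs ys. 1 / 6 + 4 / \<tau>\<^sup>2 * (?Z xs ys - \<mu>)\<^sup>2)"
      by (intro expectation_mono_finite P Q that)
    also have "\<dots> = 1 / 6 + 4 / \<tau>\<^sup>2 * ?E (\<lambda>xs ys. (?Z xs ys - \<mu>)\<^sup>2)"
      by (simp add: integrable_measure_pmf_finite[OF P] integrable_measure_pmf_finite[OF Q])
    also have "\<dots> \<le> 1 / 6 + 4 / \<tau>\<^sup>2 * (16 * real m)"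
      by (intro add_left_mono mult_left_mono var) auto
    \<comment> \<open>\<open>4 / \<tau>\<^sup>2 * (16 * m) \<le> 1 / 6\<close> amounts to
      \<open>384 * m \<le> \<tau>\<^sup>2\<close>.\<close>
    also have "\<dots> \<le> 1 / 3" using assms(5,7) by (simp add: field_simps)
    finally show ?thesis .
  qed
  have compl: "?E (\<lambda>xs ys. 1 - h xs ys) = 1 - ?E h" for h
    by (simp add: integrable_measure_pmf_finite[OF P] integrable_measure_pmf_finite[OF Q])
  let ?R = "\<lambda>xs ys. logistic (c * (?Z xs ys - \<tau>))"
  note prob = prob_run_tester[OF p q] tester_def
    prob_random_verdict[OF logistic_bounds]
  {
    assume "p = q"
    hence "\<mu> = 0" by (simp add: \<mu>)
    hence "?E ?R \<le> 1 / 3" using assms by (intro third logistic_tail) auto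
    thus "2 / 3 \<le> measure_pmf.prob
        (run_on_samples (2 * m) (2 * (r * m)) (tester {1..k} m r c \<tau>) p q) {Accept}"
      using compl[of ?R] by (simp add: prob)
  }
  {
    assume "\<alpha> < dist_TV k p q"
    hence "2 * \<tau> \<le> \<mu>"
      unfolding \<mu> using statistic_mean_ge[OF supp, of \<alpha> m] assms gap by linarith
    \<comment> \<open>Reflecting \<open>z\<close> to \<open>2 * \<tau> - z\<close> swaps acceptance
      and rejection and turns the mean into \<open>2 * \<tau> - \<mu> \<le> 0\<close>, so the same
      tail bound applies.\<close>
    hence "1 - ?R xs ys \<le> 1 / 6 + 4 / \<tau>\<^sup>2 * (?Z xs ys - \<mu>)\<^sup>2" for xs ys
      using logistic_tail[of \<tau> c "2 * \<tau> - \<mu>" "2 * \<tau> - ?Z xs ys"] assms(5,6)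
      by (simp add: algebra_simps power2_commute flip: logistic_minus)
    hence "?E (\<lambda>xs ys. 1 - ?R xs ys) \<le> 1 / 3" by (rule third)
    thus "2 / 3 \<le> measure_pmf.prob
        (run_on_samples (2 * m) (2 * (r * m)) (tester {1..k} m r c \<tau>) p q) {Reject}"
      using compl[of ?R] by (simp add: prob)
  }
qed

section \<open>Sample complexity\<close>

text \<open>Clearing the denominator leaves two noise levels times three summands, six inequalities
  in all; each uses one of the assumptions \<open>M\<close>. A third of the budget per summand gives
  \<open>240 = 3 * 2 * 8 * 5\<close> and \<open>600 = 3 * 2 * 20 * 5\<close>.\<close>

lemma parameter_gap:
  fixes x k \<alpha> \<epsilon> M :: real
  assumes pos: "k > 0" "\<alpha> > 0" "\<epsilon> > 0" "M > 0" and x: "x \<ge> 360000 * M"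
    and M: "sqrt k \<le> M * \<alpha>\<^sup>2" "k \<le> M\<^sup>2 * \<epsilon> * \<alpha>\<^sup>2" "k\<^sup>2 \<le> M ^ 3 * \<alpha> ^ 4"
      "k \<le> M ^ 3 * \<epsilon>\<^sup>2 * \<alpha> ^ 4" "1 \<le> M * \<epsilon> * \<alpha>" "1 \<le> M * \<alpha>\<^sup>2"
  shows "2 * max (8 / \<epsilon>) (20 * sqrt x) \<le> (x * \<alpha>)\<^sup>2 / (5 * (x * \<alpha> + sqrt (x * k) + k))"
proof -
  have x0: "x > 0" using x pos by linarith
  \<comment> \<open>One factor \<open>360000 = 600\<^sup>2\<close> is enough for every exponent
    \<open>n\<close>, since 600 gets squared at most once.\<close>
  have scale: "360000 * b \<le> x ^ n * c" if "b \<le> M ^ n * c" "n > 0" "c > 0" for b c n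
  proof -
    have "360000 \<le> (360000 :: real) ^ n" using that(2) by (intro self_le_power) auto
    hence "360000 * M ^ n \<le> (360000 * M) ^ n"
      unfolding power_mult_distrib using pos by (intro mult_right_mono) auto
    also have "\<dots> \<le> x ^ n" using x pos by (intro power_mono) auto
    finally have "360000 * M ^ n * c \<le> x ^ n * c" using that(3) by (intro mult_right_mono) auto
    thus ?thesis using that(1) by linarith
  qed
  have sqrt_bound: "a * sqrt y \<le> z" if "a\<^sup>2 * y \<le> z\<^sup>2" "0 \<le> z" "0 \<le> a" for a y z :: real
  proof -
    have "sqrt (a\<^sup>2 * y) \<le> z" using that by (intro real_le_lsqrt) auto
    thus ?thesis using that by (simp add: real_sqrt_mult)
  qed
  have z4: "((x * \<alpha>)\<^sup>2)\<^sup>2 = x * (x ^ 3 * \<alpha> ^ 4)"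
    by (simp add: power_mult_distrib eval_nat_numeral algebra_simps)
  have A1: "600 * sqrt x * (x * \<alpha>) \<le> (x * \<alpha>)\<^sup>2"
  proof -
    have "360000 \<le> x * \<alpha>\<^sup>2" using scale[of 1 1 "\<alpha>\<^sup>2"] M(6) pos by simp
    hence "600\<^sup>2 * x \<le> (x * \<alpha>)\<^sup>2"
      using x0 mult_left_mono[of 360000 "x * \<alpha>\<^sup>2" x] by (simp add: power2_eq_square algebra_simps)
    hence "600 * sqrt x \<le> x * \<alpha>" using x0 pos by (intro sqrt_bound) auto
    hence "600 * sqrt x * (x * \<alpha>) \<le> x * \<alpha> * (x * \<alpha>)"
      using x0 pos by (intro mult_right_mono) auto
    thus ?thesis by (simp add: power2_eq_square)
  qed
  have A2: "600 * sqrt x * sqrt (x * k) \<le> (x * \<alpha>)\<^sup>2"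
  proof -
    have "600 * sqrt x * sqrt (x * k) = x * (600 * sqrt k)"
      using x0 by (simp add: real_sqrt_mult)
    also have "\<dots> \<le> x * (x * \<alpha>\<^sup>2)"
    proof (rule mult_left_mono)
      have "360000 * sqrt k \<le> x * \<alpha>\<^sup>2" using scale[of "sqrt k" 1 "\<alpha>\<^sup>2"] M(1) pos by simp
      thus "600 * sqrt k \<le> x * \<alpha>\<^sup>2" using real_sqrt_gt_zero[OF pos(1)] by linarith
    qed (use x0 in simp)
    finally show ?thesis by (simp add: power2_eq_square algebra_simps)
  qed
  have A3: "600 * sqrt x * k \<le> (x * \<alpha>)\<^sup>2"
  proof -
    have "360000 * k\<^sup>2 \<le> x ^ 3 * \<alpha> ^ 4" using scale[of "k\<^sup>2" 3 "\<alpha> ^ 4"] M(3) pos by simp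
    hence "(600 * k)\<^sup>2 * x \<le> ((x * \<alpha>)\<^sup>2)\<^sup>2"
      unfolding z4 using mult_left_mono[of "360000 * k\<^sup>2" "x ^ 3 * \<alpha> ^ 4" x] x0
      by (simp add: power_mult_distrib mult.commute)
    hence "600 * k * sqrt x \<le> (x * \<alpha>)\<^sup>2" using pos by (intro sqrt_bound) auto
    thus ?thesis by (simp add: mult_ac)
  qed
  have B1: "240 / \<epsilon> * (x * \<alpha>) \<le> (x * \<alpha>)\<^sup>2"
  proof -
    have "360000 \<le> x * (\<epsilon> * \<alpha>)" using scale[of 1 1 "\<epsilon> * \<alpha>"] M(5) pos by (simp add: mult.assoc)
    hence "240 / \<epsilon> \<le> x * \<alpha>" using pos by (simp add: divide_le_eq mult_ac)
    hence "240 / \<epsilon> * (x * \<alpha>) \<le> x * \<alpha> * (x * \<alpha>)" using x0 pos by (intro mult_right_mono) auto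
    thus ?thesis by (simp add: power2_eq_square)
  qed
  have B2: "240 / \<epsilon> * sqrt (x * k) \<le> (x * \<alpha>)\<^sup>2"
  proof (rule sqrt_bound)
    have "360000 * k \<le> x ^ 3 * (\<epsilon>\<^sup>2 * \<alpha> ^ 4)"
      using scale[of k 3 "\<epsilon>\<^sup>2 * \<alpha> ^ 4"] M(4) pos by (simp add: mult.assoc)
    hence "57600 * k \<le> x ^ 3 * (\<epsilon>\<^sup>2 * \<alpha> ^ 4)" using pos(1) by linarith
    hence "x * (57600 * k / \<epsilon>\<^sup>2) \<le> x * (x ^ 3 * \<alpha> ^ 4)"
      using pos x0 by (intro mult_left_mono) (auto simp: field_simps)
    thus "(240 / \<epsilon>)\<^sup>2 * (x * k) \<le> ((x * \<alpha>)\<^sup>2)\<^sup>2"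
      unfolding z4 by (simp add: power_divide mult_ac)
  qed (use pos in auto)
  have B3: "240 / \<epsilon> * k \<le> (x * \<alpha>)\<^sup>2"
  proof -
    have "360000 * k \<le> x\<^sup>2 * (\<epsilon> * \<alpha>\<^sup>2)"
      using scale[of k 2 "\<epsilon> * \<alpha>\<^sup>2"] M(2) pos by (simp add: mult.assoc)
    hence "240 * k \<le> x\<^sup>2 * (\<epsilon> * \<alpha>\<^sup>2)" using pos(1) by linarith
    thus ?thesis using pos by (simp add: field_simps)
  qed
  let ?S = "x * \<alpha> + sqrt (x * k) + k"
  have S: "?S > 0" using x0 pos by (simp add: add_pos_pos)
  have "240 / \<epsilon> * ?S \<le> 3 * (x * \<alpha>)\<^sup>2" "600 * sqrt x * ?S \<le> 3 * (x * \<alpha>)\<^sup>2"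
    using A1 A2 A3 B1 B2 B3 unfolding ring_distribs by linarith+
  moreover have "2 * (8 / \<epsilon>) * (5 * S) = 240 / \<epsilon> * S / 3"
    "2 * (20 * sqrt x) * (5 * S) = 600 * sqrt x * S / 3" for S
    by simp_all
  ultimately have "2 * (8 / \<epsilon>) * (5 * ?S) \<le> (x * \<alpha>)\<^sup>2"
    "2 * (20 * sqrt x) * (5 * ?S) \<le> (x * \<alpha>)\<^sup>2"
    by linarith+
  hence "2 * max (8 / \<epsilon>) (20 * sqrt x) * (5 * ?S) \<le> (x * \<alpha>)\<^sup>2"
    unfolding max_def by presburger
  thus ?thesis using S by (simp add: pos_le_divide_eq)
qed

text \<open>Squaring or cubing removes the fractional exponents; the last bound follows from the
  first by \<open>k \<ge> 1\<close>.\<close>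

lemma powr_bounds:
  fixes k \<alpha> \<epsilon> M :: real
  assumes pos: "k \<ge> 1" "\<alpha> > 0" "\<epsilon> > 0"
    and M: "k powr (1/2) / \<alpha>^2 \<le> M" "k powr (1/2) / (\<epsilon> powr (1/2) * \<alpha>) \<le> M"
      "k powr (2/3) / \<alpha> powr (4/3) \<le> M"
      "k powr (1/3) / (\<epsilon> powr (2/3) * \<alpha> powr (4/3)) \<le> M" "1 / (\<epsilon> * \<alpha>) \<le> M"
  shows "sqrt k \<le> M * \<alpha>\<^sup>2" "k \<le> M\<^sup>2 * \<epsilon> * \<alpha>\<^sup>2" "k\<^sup>2 \<le> M ^ 3 * \<alpha> ^ 4"
      "k \<le> M ^ 3 * \<epsilon>\<^sup>2 * \<alpha> ^ 4" "1 \<le> M * \<epsilon> * \<alpha>" "1 \<le> M * \<alpha>\<^sup>2"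
proof -
  have pw: "(y powr a) ^ n = y powr (a * real n)" if "y > 0" for y a :: real and n
    using that by (simp add: powr_powr flip: powr_realpow)
  have a4: "(\<alpha> powr (4/3)) ^ 3 = \<alpha> ^ 4" and e2: "(\<epsilon> powr (2/3)) ^ 3 = \<epsilon>\<^sup>2"
    and k2: "(k powr (2/3)) ^ 3 = k\<^sup>2" and k1: "(k powr (1/3)) ^ 3 = k"
    and e1: "(\<epsilon> powr (1/2))\<^sup>2 = \<epsilon>" and k3: "(k powr (1/2))\<^sup>2 = k"
    using pos by (simp_all add: pw)
  show 1: "sqrt k \<le> M * \<alpha>\<^sup>2" using M(1) pos by (simp add: powr_half_sqrt pos_divide_le_eq)
  show "1 \<le> M * \<alpha>\<^sup>2" using pos by (intro order.trans[OF _ 1]) simp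
  show "1 \<le> M * \<epsilon> * \<alpha>" using M(5) pos by (simp add: pos_divide_le_eq mult.assoc)
  have "(k powr (1/2) / (\<epsilon> powr (1/2) * \<alpha>))\<^sup>2 \<le> M\<^sup>2"
    using M(2) pos by (intro power_mono) auto
  thus "k \<le> M\<^sup>2 * \<epsilon> * \<alpha>\<^sup>2"
    using pos by (simp add: power_divide power_mult_distrib e1 k3 pos_divide_le_eq mult.assoc)
  have "(k powr (2/3) / \<alpha> powr (4/3)) ^ 3 \<le> M ^ 3"
    using M(3) pos by (intro power_mono) auto
  thus "k\<^sup>2 \<le> M ^ 3 * \<alpha> ^ 4"
    using pos by (simp add: power_divide k2 a4 pos_divide_le_eq)
  have "(k powr (1/3) / (\<epsilon> powr (2/3) * \<alpha> powr (4/3))) ^ 3 \<le> M ^ 3"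
    using M(4) pos by (intro power_mono) auto
  thus "k \<le> M ^ 3 * \<epsilon>\<^sup>2 * \<alpha> ^ 4"
    using pos by (simp add: power_divide power_mult_distrib k1 e2 a4 pos_divide_le_eq mult.assoc)
qed

theorem theorem3p10:
  shows "\<exists>C1 > (0::real). \<exists>C2 > (0::real).
    \<forall>(k::nat) (\<alpha>::real) (\<epsilon>1::real) (\<epsilon>2::real).
      k \<ge> 2 \<longrightarrow> 0 < \<alpha> \<longrightarrow> \<alpha> \<le> 1 \<longrightarrow> 0 < \<epsilon>1 \<longrightarrow> 0 < \<epsilon>2 \<longrightarrow> \<epsilon>2 \<le> \<epsilon>1 \<longrightarrow>
      (\<exists>(n1::nat) (n2::nat) (A :: nat list \<Rightarrow> nat list \<Rightarrow> verdict pmf).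
         real n1 \<le> C1 * Max {real k powr (1/2) / \<alpha>^2,
                              real k powr (1/2) / (\<epsilon>1 powr (1/2) * \<alpha>),
                              real k powr (2/3) / \<alpha> powr (4/3),
                              real k powr (1/3) / (\<epsilon>1 powr (2/3) * \<alpha> powr (4/3)),
                              1 / (\<epsilon>1 * \<alpha>)} \<and>
         real n2 \<le> C2 * (\<epsilon>1 / \<epsilon>2) * real n1 \<and>
         closeness_tester k \<alpha> n1 n2 A \<and>
         private_to_first k \<epsilon>1 n1 n2 A \<and>
         private_to_second k \<epsilon>2 n1 n2 A)"
proof (rule exI[of _ 720002], rule conjI, simp, rule exI[of _ 2], rule conjI, simp,
    intro allI impI)
  fix k :: nat and \<alpha> \<epsilon>1 \<epsilon>2 :: real
  assume k: "2 \<le> k" and \<alpha>: "0 < \<alpha>" "\<alpha> \<le> 1" and \<epsilon>: "0 < \<epsilon>1" "0 < \<epsilon>2" "\<epsilon>2 \<le> \<epsilon>1"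
  let ?bounds = "{real k powr (1/2) / \<alpha>^2,
                              real k powr (1/2) / (\<epsilon>1 powr (1/2) * \<alpha>),
                              real k powr (2/3) / \<alpha> powr (4/3),
                              real k powr (1/3) / (\<epsilon>1 powr (2/3) * \<alpha> powr (4/3)),
                              1 / (\<epsilon>1 * \<alpha>)}"
  define M where "M = Max ?bounds"
  have "b \<le> M" if "b \<in> ?bounds" for b
    unfolding M_def using that by (intro Max_ge) auto
  hence "real k powr (1/2) / \<alpha>^2 \<le> M" "real k powr (1/2) / (\<epsilon>1 powr (1/2) * \<alpha>) \<le> M"
    "real k powr (2/3) / \<alpha> powr (4/3) \<le> M"
    "real k powr (1/3) / (\<epsilon>1 powr (2/3) * \<alpha> powr (4/3)) \<le> M" "1 / (\<epsilon>1 * \<alpha>) \<le> M"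
    by blast+
  note bounds = powr_bounds[OF _ \<alpha>(1) \<epsilon>(1) this]
  have k1: "real k \<ge> 1" using k by simp
  have "1 \<le> M * \<alpha>\<^sup>2" using bounds(6) k1 .
  moreover have "\<alpha>\<^sup>2 \<le> 1" "\<alpha>\<^sup>2 > 0" using \<alpha> by (simp_all add: power_le_one)
  ultimately have M1: "M \<ge> 1"
    by (smt (verit) mult_less_cancel_right1 mult_le_cancel_right1 mult_nonneg_nonpos2 mult_mono)
  \<comment> \<open>Rounding up costs at most \<open>1 \<le> M\<close>, hence 360001; the two halves
    double this to 720002.\<close>
  define m where "m = nat \<lceil>360000 * M\<rceil>"
  have m: "real m \<ge> 360000 * M" "real m \<le> 360001 * M"
    unfolding m_def using M1 by linarith+
  have m0: "m > 0" using m M1 by linarith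
  \<comment> \<open>Since the ratio is at least 1, rounding up at most doubles it; this is the
    constant 2 for \<open>n2\<close>.\<close>
  define r where "r = nat \<lceil>\<epsilon>1 / \<epsilon>2\<rceil>"
  have ratio: "\<epsilon>1 / \<epsilon>2 \<ge> 1" using \<epsilon> by simp
  have r: "real r \<ge> \<epsilon>1 / \<epsilon>2" "real r \<le> 2 * (\<epsilon>1 / \<epsilon>2)"
    unfolding r_def using ratio by linarith+
  have r0: "r > 0" using r ratio by linarith
  \<comment> \<open>The first term gives \<open>\<epsilon>1 / 2 * \<tau> \<ge> 4\<close>, the second
    \<open>\<tau>\<^sup>2 \<ge> 400 * m\<close>.\<close>
  define \<tau> where "\<tau> = max (8 / \<epsilon>1) (20 * sqrt m)"
  define A where "A = tester {1..k} m r (\<epsilon>1 / 2) \<tau>"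
  have \<tau>: "8 / \<epsilon>1 \<le> \<tau>" "20 * sqrt m \<le> \<tau>" by (simp_all add: \<tau>_def)
  have "\<tau> > 0" using \<tau>(1) \<epsilon>(1) by (smt (verit) divide_pos_pos)
  moreover have "\<epsilon>1 / 2 * \<tau> \<ge> 4" using \<tau>(1) \<epsilon>(1) by (simp add: field_simps)
  moreover have "384 * real m \<le> \<tau>\<^sup>2"
  proof -
    have "384 * real m \<le> (20 * sqrt m)\<^sup>2" by (simp add: power_mult_distrib)
    also have "\<dots> \<le> \<tau>\<^sup>2" using \<tau>(2) by (intro power_mono) auto
    finally show ?thesis .
  qed
  moreover have "2 * \<tau> \<le> (m * \<alpha>)\<^sup>2 / (5 * (m * \<alpha> + sqrt (m * k) + k))"
    unfolding \<tau>_def of_nat_mult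
    by (rule parameter_gap[OF _ \<alpha>(1) \<epsilon>(1) _ m(1)]) (use M1 k1 bounds in auto)
  ultimately have "closeness_tester k \<alpha> (2 * m) (2 * (r * m)) A"
    unfolding A_def using r0 m0 k \<alpha> by (intro closeness_tester_tester) auto
  moreover have "private_to_first k \<epsilon>1 (2 * m) (2 * (r * m)) A"
    unfolding A_def using \<epsilon> by (intro tester_private_to_first) auto
  moreover have "private_to_second k \<epsilon>2 (2 * m) (2 * (r * m)) A"
    unfolding A_def using \<epsilon> r(1) r0 by (intro tester_private_to_second) (auto simp: field_simps)
  moreover have "real (2 * m) \<le> 720002 * M" using m by simp
  moreover have "real (2 * (r * m)) \<le> 2 * (\<epsilon>1 / \<epsilon>2) * real (2 * m)"
    using mult_right_mono[OF r(2), of "real (2 * m)"] by simp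
  ultimately show "\<exists>n1 n2 A. real n1 \<le> 720002 * Max ?bounds \<and>
      real n2 \<le> 2 * (\<epsilon>1 / \<epsilon>2) * real n1 \<and> closeness_tester k \<alpha> n1 n2 A \<and>
      private_to_first k \<epsilon>1 n1 n2 A \<and> private_to_second k \<epsilon>2 n1 n2 A"
    unfolding M_def by blast
qed

end
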